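(* There is an integer $N$ such that for all integers $n\ge N$ and all integers $\lambda$ with $0\le\lambda\le n$: (i) $f(n,2,\lambda)\le 2n-2$; (ii) $f(n,2,\lambda)\le \frac13\left(5n+4\min\left\{\lambda,\frac{n-\lambda}{3}\right\}+7\right)$. Moreover: (iii) if $\lambda=\lambda(n)$ is a sequence of integers with $0\le\lambda(n)\le n$ and $\lambda(n)=o(n)$ as $n\to\infty$, then $f(n,2,\lambda(n))\le\left(\frac32+o(1)\right)n$ as $n\to\infty$.
   Context: Let $[n]=\{1,\dots,n\}$. For non-negative integers $k,\lambda$, a family (set of distinct subsets) $\mathcal{F}\subset 2^{[n]}$ is called $k$-almost $\lambda$-Fisher if for every $F\in\mathcal{F}$ there are at most $k$ other sets $F'\in\mathcal{F}\setminus\{F\}$ with $|F\cap F'|\neq\lambda$. Define $f(n,k,\lambda)=\max\{|\mathcal{F}| : \mathcal{F}\subset 2^{[n]} \text{ is a } k\text{-almost } \lambda\text{-Fisher family}\}$. *)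

theory Defs
  imports Complex_Main "HOL-Library.Landau_Symbols"
begin

definition almost_fisher :: "nat \<Rightarrow> nat \<Rightarrow> nat \<Rightarrow> nat set set \<Rightarrow> bool" where
  "almost_fisher n k l \<F> \<longleftrightarrow>
     \<F> \<subseteq> Pow {1..n} \<and>
     (\<forall>F\<in>\<F>. card {F' \<in> \<F> - {F}. card (F \<inter> F') \<noteq> l} \<le> k)"

definition max_almost_fisher :: "nat \<Rightarrow> nat \<Rightarrow> nat \<Rightarrow> nat" where
  "max_almost_fisher n k l = Max {card \<F> | \<F>. almost_fisher n k l \<F>}"

(* The maximum is taken over a finite nonempty set, so Max is meaningful. *)
lemma finite_almost_fisher_cards: "finite {card \<F> | \<F>. almost_fisher n k l \<F>}"
proof -
  have "{\<F>. almost_fisher n k l \<F>} \<subseteq> Pow (Pow {1..n})"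
    by (auto simp: almost_fisher_def)
  then have "finite {\<F>. almost_fisher n k l \<F>}"
    by (rule finite_subset) simp
  then show ?thesis
    by simp
qed

lemma almost_fisher_cards_nonempty: "{card \<F> | \<F>. almost_fisher n k l \<F>} \<noteq> {}"
proof -
  have "almost_fisher n k l {}"
    by (simp add: almost_fisher_def)
  then show ?thesis
    by blast
qed

end

theory Submission
  imports Defs
begin

text \<open>
  Call two members of the family adjacent if their intersection does not have size \<open>l\<close>; the
  components of this graph are paths and cycles.  Let \<open>M\<close> be the matrix with entries
  \<open>b A B = |A \<inter> B| - l\<close>, which is block diagonal along the components and has rank at most \<open>n + 1\<close>.
  A kernel vector of \<open>M\<close> with coefficient sum \<open>s\<close> satisfies \<open>|\<Sum> k A A|\<^sup>2 = l s\<^sup>2\<close>.  So it is either an affine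
  dependency of \<open>0/1\<close>-vectors (\<open>s = 0\<close>), or it expresses, after normalisation, a vector \<open>u\<close> with
  \<open>|u|\<^sup>2 = l\<close> and inner product \<open>l\<close> with every member.  This \<open>u\<close> is the same for all components, and
  its existence lowers the rank of \<open>M\<close> to \<open>n - 1\<close> (to \<open>n\<close> if \<open>l = 0\<close>).

  A component with \<open>c\<close> members and rank \<open>r\<close> satisfies \<open>2 c \<le> 3 r\<close> unless \<open>(c, r)\<close> is one of
  \<open>(1, 0)\<close>, \<open>(2, 1)\<close>, \<open>(4, 2)\<close>, \<open>(5, 3)\<close>, and such a bad component forces \<open>u\<close> to exist.  The values of
  \<open>u\<close> restrict the bad components: the first kind occurs at most once.  Those of the second kind are
  pairs \<open>A, B\<close> with \<open>2 u = A + B\<close>, whose differences \<open>A - B\<close> are mutually orthogonal and supported on the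
  set where \<open>u = 1/2\<close>, of size at most \<open>4 min {l, (n - l) / 3}\<close>; otherwise there is at most one
  component of the second and third kind together.  A component of the last kind contains two sets
  which differ only on the support of \<open>u\<close>, and that support has at most \<open>25 l\<close> elements if there are
  two such components.
\<close>

section \<open>Orthogonality and affine relations of 0/1-vectors\<close>

text \<open>Gaussian elimination, one coordinate of \<open>E\<close> at a time: a vector that does
  not vanish at the new coordinate is the pivot, and one vector fewer remains for the other
  coordinates.\<close>

lemma linear_relation_exists:
  fixes w :: "'i \<Rightarrow> 'e \<Rightarrow> real"
  assumes "finite E" "finite I" "card E < card I"
  shows "\<exists>c. (\<exists>i\<in>I. c i \<noteq> 0) \<and> (\<forall>e\<in>E. (\<Sum>i\<in>I. c i * w i e) = 0)"
  using assms
proof (induction E arbitrary: I w rule: finite_induct)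
  case empty
  then have "I \<noteq> {}" by auto
  then show ?case by (intro exI[of _ "\<lambda>_. 1"]) auto
next
  case (insert e0 E)
  show ?case
  proof (cases "\<forall>i\<in>I. w i e0 = 0")
    case True
    have "card E < card I" using insert by simp
    from insert.IH[OF insert.prems(1) this, of w] obtain c where
      "\<exists>i\<in>I. c i \<noteq> 0" "\<forall>e\<in>E. (\<Sum>i\<in>I. c i * w i e) = 0" by auto
    then show ?thesis using True by (intro exI[of _ c]) auto
  next
    case False
    then obtain i0 where i0: "i0 \<in> I" "w i0 e0 \<noteq> 0" by auto
    let ?J = "I - {i0}"
    let ?w = "\<lambda>i e. w i e - w i e0 / w i0 e0 * w i0 e"
    have J: "finite ?J" "card E < card ?J" using insert i0 by auto
    from insert.IH[OF J, of ?w] obtain c where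
      c: "\<exists>i\<in>?J. c i \<noteq> 0" "\<forall>e\<in>E. (\<Sum>i\<in>?J. c i * ?w i e) = 0" by auto
    \<comment> \<open>The coefficient of the pivot is chosen so that the relation holds at
      \<open>e0\<close>.\<close>
    let ?t = "- (\<Sum>i\<in>?J. c i * w i e0) / w i0 e0"
    let ?c = "c(i0 := ?t)"
    have split: "(\<Sum>i\<in>I. ?c i * w i e) = ?t * w i0 e + (\<Sum>i\<in>?J. c i * w i e)" for e
    proof -
      have "(\<Sum>i\<in>I. ?c i * w i e) = ?c i0 * w i0 e + (\<Sum>i\<in>?J. ?c i * w i e)"
        using insert.prems(1) i0(1) by (rule sum.remove)
      also have "(\<Sum>i\<in>?J. ?c i * w i e) = (\<Sum>i\<in>?J. c i * w i e)"
        by (intro sum.cong) auto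
      finally show ?thesis by simp
    qed
    have "(\<Sum>i\<in>?J. c i * ?w i e) = ?t * w i0 e + (\<Sum>i\<in>?J. c i * w i e)" for e
      by (simp add: algebra_simps sum_subtractf sum_distrib_left sum_distrib_right sum_divide_distrib)
    then have "(\<Sum>i\<in>I. ?c i * w i e) = (\<Sum>i\<in>?J. c i * ?w i e)" for e using split by simp
    moreover have "(\<Sum>i\<in>?J. c i * ?w i e0) = 0" using i0 by simp
    ultimately have "\<forall>e\<in>insert e0 E. (\<Sum>i\<in>I. ?c i * w i e) = 0" using c(2) by auto
    moreover have "\<exists>i\<in>I. ?c i \<noteq> 0" using c(1) by auto
    ultimately show ?thesis by blast
  qed
qed

lemma card_le_of_independent:
  fixes w :: "'i \<Rightarrow> 'e \<Rightarrow> real"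
  assumes "finite E" "finite I"
    and "\<And>c. \<forall>e\<in>E. (\<Sum>i\<in>I. c i * w i e) = 0 \<Longrightarrow> \<forall>i\<in>I. c i = 0"
  shows "card I \<le> card E"
  using linear_relation_exists[OF assms(1,2), of w] assms(3) by (meson not_le)

text \<open>The inner product of a linear relation with \<open>w j\<close> isolates
  \<open>c j\<close>, so the vectors are independent; as they vanish on \<open>D - E\<close>, a
  relation need only be tested on \<open>E\<close>.\<close>

lemma card_le_of_orthogonal:
  fixes w :: "'i \<Rightarrow> 'e \<Rightarrow> real"
  assumes "finite D" "E \<subseteq> D" "finite I"
    and supp: "\<And>i e. i \<in> I \<Longrightarrow> e \<in> D - E \<Longrightarrow> w i e = 0"
    and orth: "\<And>i j. i \<in> I \<Longrightarrow> j \<in> I \<Longrightarrow> i \<noteq> j \<Longrightarrow> (\<Sum>e\<in>D. w i e * w j e) = 0"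
    and nz: "\<And>i. i \<in> I \<Longrightarrow> \<exists>e\<in>D. w i e \<noteq> 0"
  shows "card I \<le> card E"
proof (rule card_le_of_independent)
  show "finite E" using assms finite_subset by blast
  show "finite I" by fact
next
  fix c assume c: "\<forall>e\<in>E. (\<Sum>i\<in>I. c i * w i e) = 0"
  have c0: "(\<Sum>i\<in>I. c i * w i e) = 0" if "e \<in> D" for e
    using c supp that by (cases "e \<in> E") auto
  show "\<forall>i\<in>I. c i = 0"
  proof
    fix j assume j: "j \<in> I"
    have "0 = (\<Sum>e\<in>D. (\<Sum>i\<in>I. c i * w i e) * w j e)" using c0 by simp
    also have "\<dots> = (\<Sum>i\<in>I. c i * (\<Sum>e\<in>D. w i e * w j e))"
      by (simp add: sum_distrib_left sum_distrib_right mult.assoc) (rule sum.swap)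
    also have "\<dots> = c j * (\<Sum>e\<in>D. w j e * w j e)"
      using orth j assms(3) by (subst sum.remove[OF assms(3) j]) auto
    finally have "c j = 0 \<or> (\<Sum>e\<in>D. w j e * w j e) = 0" by auto
    moreover have "(\<Sum>e\<in>D. w j e * w j e) \<noteq> 0"
      using nz[OF j] assms(1) by (subst sum_nonneg_eq_0_iff) auto
    ultimately show "c j = 0" by simp
  qed
qed

abbreviation ind :: "nat set \<Rightarrow> nat \<Rightarrow> real" where
  "ind A e \<equiv> of_bool (e \<in> A)"

lemma affine_relation_two:
  assumes "\<And>e. \<alpha> * ind A e + \<beta> * ind B e = 0" "\<alpha> + \<beta> = 0" "A \<noteq> B"
  shows "\<alpha> = 0" "\<beta> = 0"
proof -
  obtain e where "e \<in> A \<longleftrightarrow> e \<notin> B" using assms(3) by auto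
  then show "\<alpha> = 0" "\<beta> = 0" using assms(1)[of e] assms(2) by (cases "e \<in> A"; simp)+
qed

text \<open>No three vertices of the cube are collinear: at a coordinate that separates
  \<open>A\<close> from \<open>B\<close>, the relation and the zero sum make one coefficient
  vanish.\<close>

lemma affine_relation_three:
  assumes r: "\<And>e. \<alpha> * ind A e + \<beta> * ind B e + \<gamma> * ind C e = 0" and s: "\<alpha> + \<beta> + \<gamma> = 0"
    and d: "A \<noteq> B" "A \<noteq> C" "B \<noteq> C"
  shows "\<alpha> = 0 \<and> \<beta> = 0 \<and> \<gamma> = 0"
proof -
  have "\<alpha> = 0 \<or> \<beta> = 0 \<or> \<gamma> = 0"
  proof (rule ccontr)
    assume nz: "\<not> ?thesis"
    obtain e where e: "e \<in> A \<longleftrightarrow> e \<notin> B" using d(1) by auto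
    show False using r[of e] s e nz by (cases "e \<in> A"; cases "e \<in> B"; cases "e \<in> C") auto
  qed
  then show ?thesis
  proof (elim disjE)
    assume z: "\<alpha> = 0"
    have "\<beta> * ind B e + \<gamma> * ind C e = 0" for e using r[of e] z by simp
    from affine_relation_two[OF this] s d z show ?thesis by simp
  next
    assume z: "\<beta> = 0"
    have "\<alpha> * ind A e + \<gamma> * ind C e = 0" for e using r[of e] z by simp
    from affine_relation_two[OF this] s d z show ?thesis by simp
  next
    assume z: "\<gamma> = 0"
    have "\<alpha> * ind A e + \<beta> * ind B e = 0" for e using r[of e] z by simp
    from affine_relation_two[OF this] s d z show ?thesis by simp
  qed
qed

text \<open>Four affinely dependent vertices of the cube form a parallelogram. No coefficient
  vanishes, so the sets containing a given coordinate are all, none, or two whose coefficients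
  cancel.\<close>

lemma affine_relation_four:
  assumes r: "\<And>e. \<alpha> * ind A e + \<beta> * ind B e + \<gamma> * ind C e + \<delta> * ind D e = 0"
    and s: "\<alpha> + \<beta> + \<gamma> + \<delta> = 0"
    and nz: "\<not> (\<alpha> = 0 \<and> \<beta> = 0 \<and> \<gamma> = 0 \<and> \<delta> = 0)"
    and d: "A \<noteq> B" "A \<noteq> C" "B \<noteq> C" "A \<noteq> D" "B \<noteq> D" "C \<noteq> D"
  shows "(\<forall>e. ind A e + ind B e = ind C e + ind D e) \<or>
         (\<forall>e. ind A e + ind C e = ind B e + ind D e) \<or>
         (\<forall>e. ind A e + ind D e = ind B e + ind C e)"
proof -
  have nz4: "\<alpha> \<noteq> 0" "\<beta> \<noteq> 0" "\<gamma> \<noteq> 0" "\<delta> \<noteq> 0"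
  proof -
    show "\<alpha> \<noteq> 0"
    proof
      assume z: "\<alpha> = 0"
      have "\<beta> * ind B e + \<gamma> * ind C e + \<delta> * ind D e = 0" for e using r[of e] z by simp
      from affine_relation_three[OF this] s d nz z show False by simp
    qed
    show "\<beta> \<noteq> 0"
    proof
      assume z: "\<beta> = 0"
      have "\<alpha> * ind A e + \<gamma> * ind C e + \<delta> * ind D e = 0" for e using r[of e] z by simp
      from affine_relation_three[OF this] s d nz z show False by simp
    qed
    show "\<gamma> \<noteq> 0"
    proof
      assume z: "\<gamma> = 0"
      have "\<alpha> * ind A e + \<beta> * ind B e + \<delta> * ind D e = 0" for e using r[of e] z by simp
      from affine_relation_three[OF this] s d nz z show False by simp
    qed
    show "\<delta> \<noteq> 0"
    proof
      assume z: "\<delta> = 0"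
      have "\<alpha> * ind A e + \<beta> * ind B e + \<gamma> * ind C e = 0" for e using r[of e] z by simp
      from affine_relation_three[OF this] s d nz z show False by simp
    qed
  qed
  have ty: "(e \<in> A \<and> e \<in> B \<and> e \<in> C \<and> e \<in> D) \<or> (e \<notin> A \<and> e \<notin> B \<and> e \<notin> C \<and> e \<notin> D) \<or>
      (\<alpha> + \<beta> = 0 \<and> (e \<in> A \<longleftrightarrow> e \<in> B) \<and> (e \<in> C \<longleftrightarrow> e \<in> D) \<and> (e \<in> A \<longleftrightarrow> e \<notin> C)) \<or>
      (\<alpha> + \<gamma> = 0 \<and> (e \<in> A \<longleftrightarrow> e \<in> C) \<and> (e \<in> B \<longleftrightarrow> e \<in> D) \<and> (e \<in> A \<longleftrightarrow> e \<notin> B)) \<or>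
      (\<alpha> + \<delta> = 0 \<and> (e \<in> A \<longleftrightarrow> e \<in> D) \<and> (e \<in> B \<longleftrightarrow> e \<in> C) \<and> (e \<in> A \<longleftrightarrow> e \<notin> B))" for e
    using r[of e] s nz4 by (cases "e \<in> A"; cases "e \<in> B"; cases "e \<in> C"; cases "e \<in> D") auto
  obtain e1 where e1: "e1 \<in> A \<longleftrightarrow> e1 \<notin> B" using d by auto
  obtain e2 where e2: "e2 \<in> A \<longleftrightarrow> e2 \<notin> C" using d by auto
  obtain e3 where e3: "e3 \<in> A \<longleftrightarrow> e3 \<notin> D" using d by auto
  \<comment> \<open>All three sums zero would give \<open>\<alpha> = 0\<close> by \<open>s\<close>.
    If the sum for one pair is nonzero, no coordinate splits the four sets into that pair and its
    complement, so at each nonconstant coordinate both pairs contribute 1.\<close>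
  consider "\<alpha> + \<beta> \<noteq> 0" | "\<alpha> + \<gamma> \<noteq> 0" | "\<alpha> + \<delta> \<noteq> 0" using s nz4 by argo
  then show ?thesis
  proof cases
    case 1
    have "ind A e + ind B e = ind C e + ind D e" for e
      using ty[of e] 1 by auto
    then show ?thesis by blast
  next
    case 2
    have "ind A e + ind C e = ind B e + ind D e" for e
      using ty[of e] 2 by auto
    then show ?thesis by blast
  next
    case 3
    have "ind A e + ind D e = ind B e + ind C e" for e
      using ty[of e] 3 by auto
    then show ?thesis by blast
  qed
qed

text \<open>\<open>D\<close> and \<open>E\<close> both complete \<open>A\<close>, \<open>B\<close>,
  \<open>C\<close> to a parallelogram. Equal completions give \<open>D = E\<close>; different ones
  have one of \<open>A\<close>, \<open>B\<close>, \<open>C\<close> as midpoint of \<open>D\<close>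
  and \<open>E\<close>, impossible for distinct vertices of the cube.\<close>

lemma affine_relations_five:
  assumes r1: "\<And>e. a1 * ind A e + a2 * ind B e + a3 * ind C e + a4 * ind D e = 0"
    and s1: "a1 + a2 + a3 + a4 = 0"
    and nz1: "\<not> (a1 = 0 \<and> a2 = 0 \<and> a3 = 0 \<and> a4 = 0)"
    and r2: "\<And>e. b1 * ind A e + b2 * ind B e + b3 * ind C e + b4 * ind E e = 0"
    and s2: "b1 + b2 + b3 + b4 = 0"
    and nz2: "\<not> (b1 = 0 \<and> b2 = 0 \<and> b3 = 0 \<and> b4 = 0)"
    and d: "distinct [A, B, C, D, E]"
  shows False
proof -
  have X: "(\<forall>e. ind A e + ind B e = ind C e + ind D e) \<or>
         (\<forall>e. ind A e + ind C e = ind B e + ind D e) \<or>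
         (\<forall>e. ind A e + ind D e = ind B e + ind C e)"
    by (rule affine_relation_four[OF r1 s1 nz1]) (use d in auto)
  have Y: "(\<forall>e. ind A e + ind B e = ind C e + ind E e) \<or>
         (\<forall>e. ind A e + ind C e = ind B e + ind E e) \<or>
         (\<forall>e. ind A e + ind E e = ind B e + ind C e)"
    by (rule affine_relation_four[OF r2 s2 nz2]) (use d in auto)
  have "(\<forall>e. ind D e = ind E e) \<or> (\<forall>e. ind D e + ind E e = 2 * ind A e) \<or>
    (\<forall>e. ind D e + ind E e = 2 * ind B e) \<or> (\<forall>e. ind D e + ind E e = 2 * ind C e)"
    using X Y by (smt (verit))
  moreover have "D = G" if "\<forall>e. ind D e + ind E e = 2 * ind G e" for G
  proof -
    have "e \<in> D \<longleftrightarrow> e \<in> G" for e using that[rule_format, of e]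
      by (cases "e \<in> D"; cases "e \<in> E"; cases "e \<in> G") auto
    then show ?thesis by blast
  qed
  moreover have "D = E" if "\<forall>e. ind D e = ind E e"
    using that by (metis of_bool_eq_iff set_eqI)
  ultimately have "D = E \<or> D = A \<or> D = B \<or> D = C" by blast
  then show False using d by auto
qed

section \<open>Small sets and binary words of length five\<close>

lemma card_4E:
  assumes "card C = 4"
  obtains A B D E where "C = {A, B, D, E}" "distinct [A, B, D, E]"
proof -
  have "finite C" using assms by (intro card_ge_0_finite) simp
  then obtain xs where xs: "set xs = C" "distinct xs" using finite_distinct_list by blast
  then have "length xs = 4" using assms distinct_card by metis
  then obtain A B D E where "xs = [A, B, D, E]"
    by (auto simp: numeral_eq_Suc length_Suc_conv)
  then show ?thesis using that[of A B D E] xs by auto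
qed

lemma card_5E:
  assumes "card C = 5"
  obtains A B D E G where "C = {A, B, D, E, G}" "distinct [A, B, D, E, G]"
proof -
  have "finite C" using assms by (intro card_ge_0_finite) simp
  then obtain xs where xs: "set xs = C" "distinct xs" using finite_distinct_list by blast
  then have "length xs = 5" using assms distinct_card by metis
  then obtain A B D E G where "xs = [A, B, D, E, G]"
    by (auto simp: numeral_eq_Suc length_Suc_conv)
  then show ?thesis using that[of A B D E G] xs by auto
qed

text \<open>By \<open>H\<close> a nonempty set of positions never lies inside a pair, which excludes
  weights 1 and 2; for weight 1 the second position of the pair is arbitrary.\<close>

lemma sparse_count:
  fixes m :: "'a \<Rightarrow> bool"
  assumes C: "C = {A, B, D, E, G}" "distinct [A, B, D, E, G]"
    and H: "\<And>Y Z. Y \<in> C \<Longrightarrow> Z \<in> C \<Longrightarrow> Y \<noteq> Z \<Longrightarrow> (\<And>X. X \<in> C \<Longrightarrow> X \<noteq> Y \<Longrightarrow> X \<noteq> Z \<Longrightarrow> \<not> m X) \<Longrightarrow> \<not> m Z"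
  shows "(of_bool (m A) + of_bool (m B) + of_bool (m D) + of_bool (m E) + of_bool (m G) :: nat) \<notin> {1, 2}"
proof
  let ?s = "of_bool (m A) + of_bool (m B) + of_bool (m D) + of_bool (m E) + of_bool (m G) :: nat"
  assume s: "?s \<in> {1, 2}"
  have "finite C" using C by simp
  have "card {X \<in> C. m X} = (\<Sum>X\<in>C. of_bool (m X))"
    using \<open>finite C\<close> by (simp add: Int_def)
  also have "\<dots> = ?s" using C by simp
  finally have c: "card {X \<in> C. m X} = ?s" .
  obtain Y Z where YZ: "Y \<in> C" "Z \<in> C" "Y \<noteq> Z" "m Z" "{X \<in> C. m X} \<subseteq> {Y, Z}"
  proof (cases "card {X \<in> C. m X} = 1")
    case True
    then obtain Z where Z: "{X \<in> C. m X} = {Z}" by (auto simp: card_1_singleton_iff)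
    then have ZC: "Z \<in> C" "m Z" by blast+
    obtain Y where "Y \<in> C" "Y \<noteq> Z" using C by (cases "Z = A") auto
    then show ?thesis using that[of Y Z] Z ZC by blast
  next
    case False
    then have "card {X \<in> C. m X} = 2" using c s by auto
    then obtain Y Z where Z: "{X \<in> C. m X} = {Y, Z}" "Y \<noteq> Z" by (auto simp: card_2_iff)
    then have "Y \<in> C" "Z \<in> C" "m Z" by blast+
    then show ?thesis using that[of Y Z] Z by blast
  qed
  have "\<not> m Z" by (rule H[OF YZ(1-3)]) (use YZ(5) in blast)
  then show False using YZ(4) by simp
qed

text \<open>\<open>P\<close> is a binary code whose nonzero weights and distances are at least 3. Up
  to the order of the coordinates its nonzero words are 11111 alone or lie among 11100, 10011,
  01111, so two coordinates always agree, against \<open>N\<close>.\<close>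

lemma code_distance_three:
  fixes P :: "bool \<Rightarrow> bool \<Rightarrow> bool \<Rightarrow> bool \<Rightarrow> bool \<Rightarrow> bool"
  assumes P1: "\<And>x1 x2 x3 x4 x5. P x1 x2 x3 x4 x5 \<Longrightarrow>
     (of_bool x1 + of_bool x2 + of_bool x3 + of_bool x4 + of_bool x5 :: nat) \<notin> {1, 2}"
    and P2: "\<And>x1 x2 x3 x4 x5 y1 y2 y3 y4 y5. P x1 x2 x3 x4 x5 \<Longrightarrow> P y1 y2 y3 y4 y5 \<Longrightarrow>
     (of_bool (x1 \<noteq> y1) + of_bool (x2 \<noteq> y2) + of_bool (x3 \<noteq> y3) + of_bool (x4 \<noteq> y4)
        + of_bool (x5 \<noteq> y5) :: nat) \<notin> {1, 2}"
    and N: "\<exists>x1 x2 x3 x4 x5. P x1 x2 x3 x4 x5 \<and> x1 \<noteq> x2" "\<exists>x1 x2 x3 x4 x5. P x1 x2 x3 x4 x5 \<and> x1 \<noteq> x3"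
     "\<exists>x1 x2 x3 x4 x5. P x1 x2 x3 x4 x5 \<and> x1 \<noteq> x4" "\<exists>x1 x2 x3 x4 x5. P x1 x2 x3 x4 x5 \<and> x1 \<noteq> x5"
     "\<exists>x1 x2 x3 x4 x5. P x1 x2 x3 x4 x5 \<and> x2 \<noteq> x3" "\<exists>x1 x2 x3 x4 x5. P x1 x2 x3 x4 x5 \<and> x2 \<noteq> x4"
     "\<exists>x1 x2 x3 x4 x5. P x1 x2 x3 x4 x5 \<and> x2 \<noteq> x5" "\<exists>x1 x2 x3 x4 x5. P x1 x2 x3 x4 x5 \<and> x3 \<noteq> x4"
     "\<exists>x1 x2 x3 x4 x5. P x1 x2 x3 x4 x5 \<and> x3 \<noteq> x5" "\<exists>x1 x2 x3 x4 x5. P x1 x2 x3 x4 x5 \<and> x4 \<noteq> x5"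
  shows False
proof -
  have S: "\<not> P True False False False False" "\<not> P False True False False False" "\<not> P False False True False False"
     "\<not> P False False False True False" "\<not> P False False False False True"
     "\<not> P True True False False False" "\<not> P True False True False False" "\<not> P True False False True False" "\<not> P True False False False True"
     "\<not> P False True True False False" "\<not> P False True False True False" "\<not> P False True False False True"
     "\<not> P False False True True False" "\<not> P False False True False True" "\<not> P False False False True True"
    using P1 by fastforce+
  \<comment> \<open>Only the zero word and the 16 words of weight at least 3 can occur, so each
    existential is a finite disjunction.\<close>
  have ex: "(\<exists>x1 x2 x3 x4 x5. P x1 x2 x3 x4 x5 \<and> Q x1 x2 x3 x4 x5) \<Longrightarrow>
     (P False False False False False \<and> Q False False False False False) \<or>
     (P True True True False False \<and> Q True True True False False) \<or>
     (P True True False True False \<and> Q True True False True False) \<or>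
     (P True True False False True \<and> Q True True False False True) \<or>
     (P True False True True False \<and> Q True False True True False) \<or>
     (P True False True False True \<and> Q True False True False True) \<or>
     (P True False False True True \<and> Q True False False True True) \<or>
     (P False True True True False \<and> Q False True True True False) \<or>
     (P False True True False True \<and> Q False True True False True) \<or>
     (P False True False True True \<and> Q False True False True True) \<or>
     (P False False True True True \<and> Q False False True True True) \<or>
     (P True True True True False \<and> Q True True True True False) \<or>
     (P True True True False True \<and> Q True True True False True) \<or>
     (P True True False True True \<and> Q True True False True True) \<or>
     (P True False True True True \<and> Q True False True True True) \<or>
     (P False True True True True \<and> Q False True True True True) \<or>
     (P True True True True True \<and> Q True True True True True)" for Q
  proof (elim exE conjE)
    fix x1 x2 x3 x4 x5 assume "P x1 x2 x3 x4 x5" "Q x1 x2 x3 x4 x5"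
    then show ?thesis using S by (cases x1; cases x2; cases x3; cases x4; cases x5) simp_all
  qed
  note N' = N[THEN ex, simplified]
  have D: "P x1 x2 x3 x4 x5 \<longrightarrow> (\<forall>y1 y2 y3 y4 y5. P y1 y2 y3 y4 y5 \<longrightarrow>
     (of_bool (x1 \<noteq> y1) + of_bool (x2 \<noteq> y2) + of_bool (x3 \<noteq> y3) + of_bool (x4 \<noteq> y4)
        + of_bool (x5 \<noteq> y5) :: nat) \<notin> {1, 2})" for x1 x2 x3 x4 x5
    using P2 by blast
  note D' = D[of True True True True True]
    D[of True True True True False]
    D[of True True True False True]
    D[of True True True False False]
    D[of True True False True True]
    D[of True True False True False]
    D[of True True False False True]
    D[of True False True True True]
    D[of True False True True False]
    D[of True False True False True]
    D[of True False False True True]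
    D[of False True True True True]
    D[of False True True True False]
    D[of False True True False True]
    D[of False True False True True]
    D[of False False True True True]
  note D'' = D'[unfolded all_bool_eq, simplified]
  show False using N' D'' S by (smt (z3))
qed

section \<open>Kernel vectors\<close>

locale fisher_family =
  fixes n l :: nat and Fam :: "nat set set"
  assumes fam: "almost_fisher n 2 l Fam"
begin

definition b :: "nat set \<Rightarrow> nat set \<Rightarrow> real" where
  "b A B = real (card (A \<inter> B)) - real l"

definition ip :: "(nat \<Rightarrow> real) \<Rightarrow> (nat \<Rightarrow> real) \<Rightarrow> real" where
  "ip f g = (\<Sum>e\<in>{1..n}. f e * g e)"

definition adj :: "nat set \<Rightarrow> nat set \<Rightarrow> bool" where
  "adj A B \<longleftrightarrow> A \<in> Fam \<and> B \<in> Fam \<and> A \<noteq> B \<and> b A B \<noteq> 0"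

text \<open>The kernel of \<open>M\<close>; its vectors are functions on all sets, extended by zero
  outside \<open>Fam\<close>.\<close>

definition kern :: "(nat set \<Rightarrow> real) \<Rightarrow> bool" where
  "kern k \<longleftrightarrow> (\<forall>A. A \<notin> Fam \<longrightarrow> k A = 0) \<and> (\<forall>A\<in>Fam. (\<Sum>B\<in>Fam. k B * b A B) = 0)"

text \<open>For \<open>S \<subseteq> Fam\<close>: the columns of \<open>M\<close> indexed by
  \<open>S\<close> are linearly independent.\<close>

definition kfree :: "nat set set \<Rightarrow> bool" where
  "kfree S \<longleftrightarrow> (\<forall>k. kern k \<longrightarrow> (\<forall>A. A \<notin> S \<longrightarrow> k A = 0) \<longrightarrow> (\<forall>A. k A = 0))"

definition center :: "(nat \<Rightarrow> real) \<Rightarrow> bool" where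
  "center u \<longleftrightarrow> ip u u = real l \<and> (\<forall>A\<in>Fam. ip u (ind A) = real l) \<and> (\<forall>e. e \<notin> {1..n} \<longrightarrow> u e = 0)"

lemma finite_Fam: "finite Fam"
proof -
  have "Fam \<subseteq> Pow {1..n}" using fam by (simp add: almost_fisher_def)
  then show ?thesis by (rule finite_subset) simp
qed

lemma Fam_subset: "A \<in> Fam \<Longrightarrow> A \<subseteq> {1..n}"
  using fam by (auto simp: almost_fisher_def)

lemma b_commute: "b A B = b B A"
  by (simp add: b_def Int_commute)

lemma adj_commute: "adj A B \<longleftrightarrow> adj B A"
  by (auto simp: adj_def b_commute)

lemma adj_nbrs: "A \<in> Fam \<Longrightarrow> finite {B. adj A B} \<and> card {B. adj A B} \<le> 2"
proof -
  assume A: "A \<in> Fam"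
  have "{B. adj A B} = {B \<in> Fam - {A}. card (A \<inter> B) \<noteq> l}"
    using A by (auto simp: adj_def b_def)
  then show ?thesis using fam A finite_Fam by (auto simp: almost_fisher_def)
qed

lemma adj_two: "adj A B \<Longrightarrow> adj A D \<Longrightarrow> B \<noteq> D \<Longrightarrow> {E. adj A E} = {B, D}"
proof -
  assume a: "adj A B" "adj A D" "B \<noteq> D"
  have "A \<in> Fam" using a by (simp add: adj_def)
  from adj_nbrs[OF this] have f: "finite {E. adj A E}" "card {E. adj A E} \<le> 2" by auto
  have "{B, D} \<subseteq> {E. adj A E}" using a by auto
  then show ?thesis using card_seteq[OF f(1), of "{B,D}"] f(2) a by simp
qed

lemma ip_commute: "ip f g = ip g f"
  by (simp add: ip_def mult.commute)

lemma ip_ind: "A \<in> Fam \<Longrightarrow> ip (ind A) (ind B) = real (card (A \<inter> B))"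
proof -
  assume A: "A \<in> Fam"
  have "ip (ind A) (ind B) = (\<Sum>e\<in>{1..n}. of_bool (e \<in> A \<inter> B))"
    unfolding ip_def by (intro sum.cong) auto
  also have "\<dots> = real (card ({1..n} \<inter> (A \<inter> B)))" by (simp add: Int_def)
  also have "{1..n} \<inter> (A \<inter> B) = A \<inter> B" using Fam_subset[OF A] by auto
  finally show ?thesis .
qed

lemma ip_add: "ip (\<lambda>e. f e + g e) h = ip f h + ip g h"
  by (simp add: ip_def algebra_simps sum.distrib)

lemma ip_diff: "ip (\<lambda>e. f e - g e) h = ip f h - ip g h"
  by (simp add: ip_def algebra_simps sum_subtractf)

lemma ip_scale: "ip (\<lambda>e. c * f e) h = c * ip f h"
  by (simp add: ip_def sum_distrib_left mult.assoc)

lemma ip_sum: "ip (\<lambda>e. \<Sum>i\<in>I. c i * f i e) g = (\<Sum>i\<in>I. c i * ip (f i) g)"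
proof -
  have "ip (\<lambda>e. \<Sum>i\<in>I. c i * f i e) g = (\<Sum>e\<in>{1..n}. \<Sum>i\<in>I. c i * (f i e * g e))"
    by (simp add: ip_def sum_distrib_right mult.assoc)
  also have "\<dots> = (\<Sum>i\<in>I. \<Sum>e\<in>{1..n}. c i * (f i e * g e))" by (rule sum.swap)
  finally show ?thesis by (simp add: ip_def sum_distrib_left)
qed

lemma ip_zero: "\<forall>e\<in>{1..n}. f e = 0 \<Longrightarrow> ip f g = 0"
  by (simp add: ip_def)

lemma ip_self_eq_0: "ip f f = 0 \<Longrightarrow> e \<in> {1..n} \<Longrightarrow> f e = 0"
  unfolding ip_def by (subst (asm) sum_nonneg_eq_0_iff) auto

lemma ind_outside: "A \<in> Fam \<Longrightarrow> e \<notin> {1..n} \<Longrightarrow> ind A e = 0"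
proof -
  assume "A \<in> Fam" "e \<notin> {1..n}"
  then have "e \<notin> A" using Fam_subset by blast
  then show ?thesis by simp
qed

lemma kern_linear: "kern k \<Longrightarrow> kern k' \<Longrightarrow> kern (\<lambda>A. s * k A + t * k' A)"
proof -
  assume k: "kern k" "kern k'"
  have "(\<Sum>B\<in>Fam. (s * k B + t * k' B) * b A B)
      = s * (\<Sum>B\<in>Fam. k B * b A B) + t * (\<Sum>B\<in>Fam. k' B * b A B)" for A
    by (simp add: algebra_simps sum.distrib sum_distrib_left)
  then show ?thesis using k by (auto simp: kern_def)
qed

lemma kern_outside: "kern k \<Longrightarrow> A \<notin> Fam \<Longrightarrow> k A = 0"
  by (simp add: kern_def)

text \<open>Only \<open>A\<close> and its neighbours contribute to the row of \<open>A\<close>; the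
  diagonal term stands apart because \<open>adj\<close> has no loops.\<close>

lemma kern_row:
  assumes "kern k" "A \<in> Fam" "N \<subseteq> Fam" "A \<notin> N" "{B. adj A B} \<subseteq> N"
  shows "k A * b A A + (\<Sum>B\<in>N. k B * b A B) = 0"
proof -
  have f: "finite N" using assms(3) finite_Fam by (rule finite_subset)
  have "(\<Sum>B\<in>Fam. k B * b A B) = (\<Sum>B\<in>insert A N. k B * b A B)"
    by (rule sum.mono_neutral_right) (use assms finite_Fam in \<open>auto simp: adj_def\<close>)
  then show ?thesis using assms f by (simp add: kern_def)
qed

lemma kern_ip:
  assumes "kern k" "A \<in> Fam"
  shows "ip (\<lambda>e. \<Sum>B\<in>Fam. k B * ind B e) (ind A) = real l * (\<Sum>B\<in>Fam. k B)"
proof -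
  have "ip (\<lambda>e. \<Sum>B\<in>Fam. k B * ind B e) (ind A) = (\<Sum>B\<in>Fam. k B * ip (ind B) (ind A))"
    by (rule ip_sum)
  also have "\<dots> = (\<Sum>B\<in>Fam. k B * b A B + real l * k B)"
    by (intro sum.cong) (auto simp: ip_ind b_def Int_commute algebra_simps)
  also have "\<dots> = real l * (\<Sum>B\<in>Fam. k B)"
    using assms by (simp add: sum.distrib kern_def sum_distrib_left)
  finally show ?thesis .
qed

text \<open>By the kernel equations \<open>w\<close> has the same inner product with every member,
  and \<open>w\<close> is itself a combination of members.\<close>

lemma kern_ip_self:
  assumes "kern k"
  defines "w \<equiv> \<lambda>e. \<Sum>B\<in>Fam. k B * ind B e"
  shows "ip w w = real l * (\<Sum>B\<in>Fam. k B)\<^sup>2"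
proof -
  have "ip w w = (\<Sum>B\<in>Fam. k B * ip w (ind B))"
    unfolding w_def by (subst ip_sum) (simp add: ip_commute)
  also have "\<dots> = (\<Sum>B\<in>Fam. k B * (real l * (\<Sum>B\<in>Fam. k B)))"
    using kern_ip[OF assms(1)] by (intro sum.cong) (auto simp: w_def)
  finally show ?thesis by (simp add: sum_distrib_right[symmetric] power2_eq_square)
qed

lemma kern_zero_sum:
  assumes "kern k" "(\<Sum>B\<in>Fam. k B) = 0"
  shows "(\<Sum>B\<in>Fam. k B * ind B e) = 0"
proof (cases "e \<in> {1..n}")
  case True
  then show ?thesis using ip_self_eq_0[of "\<lambda>e. \<Sum>B\<in>Fam. k B * ind B e"] kern_ip_self[OF assms(1)] assms(2)
    by simp
next
  case False
  then show ?thesis using ind_outside by (intro sum.neutral) auto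
qed

lemma kern_center:
  assumes "kern k" "(\<Sum>B\<in>Fam. k B) \<noteq> 0"
  shows "\<exists>u. center u"
proof -
  define s where "s = (\<Sum>B\<in>Fam. k B)"
  define w where "w = (\<lambda>e. \<Sum>B\<in>Fam. k B * ind B e)"
  define u where "u = (\<lambda>e. (1 / s) * w e)"
  have s: "s \<noteq> 0" using assms by (simp add: s_def)
  have "ip u u = (1 / s) * ((1 / s) * ip w w)"
    unfolding u_def by (subst ip_scale, subst ip_commute, subst ip_scale) simp
  then have "ip u u = real l" using kern_ip_self[OF assms(1)] s
    by (simp add: s_def[symmetric] w_def[symmetric] power2_eq_square)
  moreover have "ip u (ind A) = real l" if "A \<in> Fam" for A
    using kern_ip[OF assms(1) that] s unfolding u_def
    by (subst ip_scale) (simp add: s_def[symmetric] w_def[symmetric])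
  moreover have "u e = 0" if "e \<notin> {1..n}" for e
  proof -
    have "w e = 0" unfolding w_def using ind_outside that by (intro sum.neutral) auto
    then show ?thesis by (simp add: u_def)
  qed
  ultimately show ?thesis unfolding center_def by blast
qed

text \<open>With \<open>s\<close> the coefficient sum and \<open>w\<close> the combination,
  \<open>ip w w\<close>, \<open>s * ip w u\<close> and \<open>s\<^sup>2 * ip u u\<close> all equal
  \<open>l * s\<^sup>2\<close>, so \<open>w - s * u\<close> has norm zero.\<close>

lemma kern_span:
  assumes "center u" "kern k"
  shows "(\<Sum>B\<in>Fam. k B * ind B e) = (\<Sum>B\<in>Fam. k B) * u e"
proof -
  define s where "s = (\<Sum>B\<in>Fam. k B)"
  define w where "w = (\<lambda>e. \<Sum>B\<in>Fam. k B * ind B e)"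
  have uA: "ip (ind A) u = real l" if "A \<in> Fam" for A
    using assms(1) that ip_commute[of u "ind A"] by (simp add: center_def)
  have ww: "ip w w = real l * s\<^sup>2" using kern_ip_self[OF assms(2)] by (simp add: s_def w_def)
  have wu: "ip w u = real l * s"
  proof -
    have "ip w u = (\<Sum>B\<in>Fam. k B * ip (ind B) u)" unfolding w_def by (rule ip_sum)
    also have "\<dots> = (\<Sum>B\<in>Fam. k B * real l)" using uA by (intro sum.cong) auto
    finally show ?thesis by (simp add: s_def sum_distrib_left mult.commute)
  qed
  have uu: "ip u u = real l" using assms(1) by (simp add: center_def)
  let ?d = "\<lambda>e. w e - s * u e"
  have "ip ?d ?d = ip w ?d - s * ip u ?d" by (simp add: ip_diff ip_scale)
  also have "ip w ?d = ip w w - s * ip w u"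
    by (subst ip_commute) (simp add: ip_diff ip_scale ip_commute[of u w])
  also have "ip u ?d = ip w u - s * ip u u"
    by (subst ip_commute) (simp add: ip_diff ip_scale)
  finally have "ip ?d ?d = 0" using ww wu uu by (simp add: power2_eq_square algebra_simps)
  have "w e = s * u e"
  proof (cases "e \<in> {1..n}")
    case True
    then show ?thesis using ip_self_eq_0[OF \<open>ip ?d ?d = 0\<close> True] by simp
  next
    case False
    then have "w e = 0" unfolding w_def using ind_outside by (intro sum.neutral) auto
    then show ?thesis using assms(1) False by (simp add: center_def)
  qed
  then show ?thesis unfolding w_def s_def .
qed

section \<open>Upper bounds for the rank of \<open>M\<close>\<close>

lemma kfree_zero:
  assumes "kfree S" "S \<subseteq> Fam" "\<forall>A\<in>Fam. (\<Sum>B\<in>S. c B * b A B) = 0" "B \<in> S"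
  shows "c B = 0"
proof -
  let ?k = "\<lambda>A. if A \<in> S then c A else 0"
  have "(\<Sum>B\<in>Fam. ?k B * b A B) = (\<Sum>B\<in>S. c B * b A B)" for A
  proof -
    have "(\<Sum>B\<in>S. c B * b A B) = (\<Sum>B\<in>S. ?k B * b A B)" by (intro sum.cong) auto
    also have "\<dots> = (\<Sum>B\<in>Fam. ?k B * b A B)"
      by (rule sum.mono_neutral_left) (use assms finite_Fam in auto)
    finally show ?thesis by simp
  qed
  then have "kern ?k" using assms by (auto simp: kern_def)
  moreover have "\<forall>A. A \<notin> S \<longrightarrow> ?k A = 0" by simp
  ultimately have "\<forall>A. ?k A = 0" using assms(1) unfolding kfree_def by blast
  then have "?k B = 0" by blast
  then show ?thesis using assms(4) by simp
qed

text \<open>\<open>b A B\<close> is linear in \<open>ind B\<close> extended by a constant coordinate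
  1, a vector with \<open>n + 1\<close> entries; index 0, which lies in no member, holds the
  constant.\<close>

lemma rank_le:
  assumes "kfree S" "S \<subseteq> Fam"
  shows "card S \<le> n + 1"
proof -
  define w :: "nat set \<Rightarrow> nat \<Rightarrow> real" where "w = (\<lambda>A e. if e = 0 then 1 else ind A e)"
  have fS: "finite S" using assms(2) finite_Fam by (rule finite_subset)
  have "card S \<le> card {0..n}"
  proof (rule card_le_of_independent[of _ _ w])
    fix c assume c: "\<forall>e\<in>{0..n}. (\<Sum>i\<in>S. c i * w i e) = 0"
    have s: "(\<Sum>i\<in>S. c i) = 0" using c[rule_format, of 0] by (simp add: w_def)
    have e: "(\<Sum>i\<in>S. c i * ind i e) = 0" if "e \<in> {1..n}" for e
      using c[rule_format, of e] that by (simp add: w_def)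
    have "(\<Sum>B\<in>S. c B * b A B) = 0" if "A \<in> Fam" for A
    proof -
      have "(\<Sum>B\<in>S. c B * b A B) = (\<Sum>B\<in>S. c B * ip (ind B) (ind A)) - real l * (\<Sum>B\<in>S. c B)"
        unfolding sum_distrib_left sum_subtractf[symmetric]
        using assms(2) by (intro sum.cong) (auto simp: ip_ind b_def Int_commute algebra_simps subset_iff)
      also have "(\<Sum>B\<in>S. c B * ip (ind B) (ind A)) = ip (\<lambda>e. \<Sum>i\<in>S. c i * ind i e) (ind A)"
        by (rule ip_sum[symmetric])
      also have "\<dots> = 0" using e by (intro ip_zero) auto
      finally show ?thesis using s by simp
    qed
    then show "\<forall>i\<in>S. c i = 0" using kfree_zero[OF assms] by blast
  qed (use fS in auto)
  then show ?thesis by simp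
qed

text \<open>Subtracting \<open>u\<close> absorbs the \<open>- l\<close> of \<open>b\<close>, so
  \<open>M\<close> factors through vectors with \<open>n\<close> coordinates that are orthogonal to
  \<open>u\<close>.\<close>

lemma ip_center_diff:
  assumes "center u" "A \<in> Fam" "B \<in> Fam"
  shows "ip (\<lambda>e. ind B e - u e) (ind A) = b A B" "ip (\<lambda>e. ind B e - u e) u = 0"
  using assms by (auto simp: ip_diff ip_ind b_def Int_commute center_def ip_commute[of "ind B" u])

lemma rank_le_center:
  assumes "kfree S" "S \<subseteq> Fam" "center u"
  shows "card S \<le> n"
proof -
  have fS: "finite S" using assms(2) finite_Fam by (rule finite_subset)
  have "card S \<le> card {1..n}"
  proof (rule card_le_of_independent[of _ _ "\<lambda>A e. ind A e - u e"])
    fix c assume c: "\<forall>e\<in>{1..n}. (\<Sum>i\<in>S. c i * (ind i e - u e)) = 0"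
    have "(\<Sum>B\<in>S. c B * b A B) = 0" if "A \<in> Fam" for A
    proof -
      have "(\<Sum>B\<in>S. c B * b A B) = (\<Sum>B\<in>S. c B * ip (\<lambda>e. ind B e - u e) (ind A))"
        using ip_center_diff(1)[OF assms(3) that] assms(2) by (intro sum.cong) auto
      also have "\<dots> = ip (\<lambda>e. \<Sum>i\<in>S. c i * (ind i e - u e)) (ind A)" by (rule ip_sum[symmetric])
      also have "\<dots> = 0" using c by (intro ip_zero) auto
      finally show ?thesis .
    qed
    then show "\<forall>i\<in>S. c i = 0" using kfree_zero[OF assms(1,2)] by blast
  qed (use fS in auto)
  then show ?thesis by simp
qed

text \<open>\<open>u\<close> itself, indexed by \<open>None\<close>, joins the vectors
  \<open>ind A - u\<close>: it is orthogonal to them and nonzero since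
  \<open>ip u u = l > 0\<close>, so it takes up one dimension.\<close>

lemma rank_le_center_pos:
  assumes "kfree S" "S \<subseteq> Fam" "center u" "l > 0"
  shows "card S + 1 \<le> n"
proof -
  have fS: "finite S" using assms(2) finite_Fam by (rule finite_subset)
  define w where "w = (\<lambda>i e. case i of None \<Rightarrow> u e | Some A \<Rightarrow> ind A e - u e)"
  let ?I = "insert None (Some ` S)"
  have split: "(\<Sum>i\<in>?I. f i) = f None + (\<Sum>A\<in>S. f (Some A))" for f :: "nat set option \<Rightarrow> real"
    using fS by (subst sum.insert) (auto simp: sum.reindex)
  have "card ?I \<le> card {1..n}"
  proof (rule card_le_of_independent[of _ _ w])
    fix c assume c: "\<forall>e\<in>{1..n}. (\<Sum>i\<in>?I. c i * w i e) = 0"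
    have "0 = ip (\<lambda>e. \<Sum>i\<in>?I. c i * w i e) u" using c by (intro ip_zero[symmetric]) auto
    also have "\<dots> = (\<Sum>i\<in>?I. c i * ip (w i) u)" by (rule ip_sum)
    also have "\<dots> = c None * ip u u + (\<Sum>A\<in>S. c (Some A) * ip (\<lambda>e. ind A e - u e) u)"
      unfolding split by (simp add: w_def)
    also have "(\<Sum>A\<in>S. c (Some A) * ip (\<lambda>e. ind A e - u e) u) = 0"
      using ip_center_diff(2)[OF assms(3)] assms(2) by (intro sum.neutral) auto
    finally have c0: "c None = 0" using assms(3,4) by (simp add: center_def)
    have "(\<Sum>B\<in>S. c (Some B) * b A B) = 0" if "A \<in> Fam" for A
    proof -
      have "(\<Sum>B\<in>S. c (Some B) * b A B) = (\<Sum>B\<in>S. c (Some B) * ip (\<lambda>e. ind B e - u e) (ind A))"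
        using ip_center_diff(1)[OF assms(3) that] assms(2) by (intro sum.cong) auto
      also have "\<dots> = (\<Sum>i\<in>?I. c i * ip (w i) (ind A))"
        unfolding split by (simp add: w_def c0)
      also have "\<dots> = ip (\<lambda>e. \<Sum>i\<in>?I. c i * w i e) (ind A)" by (rule ip_sum[symmetric])
      also have "\<dots> = 0" using c by (intro ip_zero) auto
      finally show ?thesis .
    qed
    then have "c (Some B) = 0" if "B \<in> S" for B
      using kfree_zero[OF assms(1,2), of "\<lambda>B. c (Some B)"] that by blast
    then show "\<forall>i\<in>?I. c i = 0" using c0 by auto
  qed (use fS in auto)
  moreover have "card ?I = card S + 1" using fS by (simp add: card_image)
  ultimately show ?thesis by simp
qed

section \<open>Components and their ranks\<close>

declare sum_mult_of_bool_eq [simp del] sum_of_bool_mult_eq [simp del]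

definition comp :: "nat set \<Rightarrow> nat set set" where
  "comp A = {B. adj\<^sup>*\<^sup>* A B}"

definition comps :: "nat set set set" where
  "comps = comp ` Fam"

text \<open>For a component, the rank of its diagonal block of \<open>M\<close>, as the maximal
  number of independent columns.\<close>

definition rk :: "nat set set \<Rightarrow> nat" where
  "rk C = Max (card ` {S. S \<subseteq> C \<and> kfree S})"

lemma comp_self: "A \<in> comp A"
  by (simp add: comp_def)

lemma comp_subset: "A \<in> Fam \<Longrightarrow> comp A \<subseteq> Fam"
proof
  fix B assume "A \<in> Fam" "B \<in> comp A"
  then have "adj\<^sup>*\<^sup>* A B" by (simp add: comp_def)
  then show "B \<in> Fam" using \<open>A \<in> Fam\<close> by (induction) (auto simp: adj_def)
qed

lemma comp_eq:
  assumes "B \<in> comp A"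
  shows "comp B = comp A"
proof -
  have "symp adj" by (auto intro: sympI simp: adj_commute)
  then have "symp adj\<^sup>*\<^sup>*" by (rule symp_rtranclp)
  moreover have "adj\<^sup>*\<^sup>* A B" using assms by (simp add: comp_def)
  ultimately have "adj\<^sup>*\<^sup>* B A" by (blast dest: sympD)
  then show ?thesis using \<open>adj\<^sup>*\<^sup>* A B\<close> by (auto simp: comp_def intro: rtranclp_trans)
qed

lemma comps_eq: "C \<in> comps \<Longrightarrow> A \<in> C \<Longrightarrow> C = comp A"
  using comp_eq by (auto simp: comps_def)

lemma comps_subset: "C \<in> comps \<Longrightarrow> C \<subseteq> Fam"
  using comp_subset by (auto simp: comps_def)

lemma comps_finite: "C \<in> comps \<Longrightarrow> finite C"
  using comps_subset finite_Fam finite_subset by blast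

lemma comps_nonempty: "C \<in> comps \<Longrightarrow> C \<noteq> {}"
  using comp_self by (auto simp: comps_def)

lemma finite_comps: "finite comps"
  using finite_Fam by (simp add: comps_def)

lemma comps_adj: "C \<in> comps \<Longrightarrow> A \<in> C \<Longrightarrow> adj A B \<Longrightarrow> B \<in> C"
  using comps_eq[of C A] by (auto simp: comp_def)

lemma comps_disjoint: "C \<in> comps \<Longrightarrow> C' \<in> comps \<Longrightarrow> C \<noteq> C' \<Longrightarrow> C \<inter> C' = {}"
  using comps_eq by blast

lemma comps_b:
  assumes "C \<in> comps" "C' \<in> comps" "C \<noteq> C'" "A \<in> C" "B \<in> C'"
  shows "b A B = 0"
proof (rule ccontr)
  assume "b A B \<noteq> 0"
  then have "adj A B" using assms comps_subset comps_disjoint unfolding adj_def by blast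
  then show False using assms comps_adj comps_disjoint by blast
qed

lemma Union_comps: "\<Union>comps = Fam"
  using comps_subset comp_self by (auto simp: comps_def)

lemma card_Fam: "card Fam = (\<Sum>C\<in>comps. card C)"
proof -
  have "card (\<Union>comps) = (\<Sum>C\<in>comps. card C)"
    by (rule card_Union_disjoint)
      (use comps_disjoint comps_finite in \<open>auto simp: pairwise_def disjnt_def\<close>)
  then show ?thesis by (simp add: Union_comps)
qed

text \<open>\<open>M\<close> is block diagonal: rows of members of \<open>C\<close> see only
  \<open>C\<close>, and all other rows see nothing of \<open>C\<close>.\<close>

lemma kern_restrict:
  assumes "kern k" "C \<in> comps"
  shows "kern (\<lambda>A. if A \<in> C then k A else 0)"
  unfolding kern_def
proof (intro conjI allI impI ballI)
  fix A assume "A \<notin> Fam"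
  then show "(if A \<in> C then k A else 0) = 0" using assms by (simp add: kern_def)
next
  fix A assume A: "A \<in> Fam"
  have sp: "(\<Sum>B\<in>Fam. (if B \<in> C then k B else 0) * b A B) = (\<Sum>B\<in>C. k B * b A B)"
    by (rule sum.mono_neutral_cong_right) (use comps_subset[OF assms(2)] finite_Fam in auto)
  have A': "comp A \<in> comps" "A \<in> comp A" using A comp_self by (auto simp: comps_def)
  show "(\<Sum>B\<in>Fam. (if B \<in> C then k B else 0) * b A B) = 0"
  proof (cases "A \<in> C")
    case True
    have "(\<Sum>B\<in>C. k B * b A B) = (\<Sum>B\<in>Fam. k B * b A B)"
    proof (rule sum.mono_neutral_left)
      show "\<forall>B\<in>Fam - C. k B * b A B = 0"
      proof
        fix B assume B: "B \<in> Fam - C"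
        then have "comp B \<in> comps" "B \<in> comp B" "comp B \<noteq> C" using comp_self by (auto simp: comps_def)
        then show "k B * b A B = 0" using comps_b[of C "comp B" A B] True assms(2) by auto
      qed
    qed (use comps_subset[OF assms(2)] finite_Fam in auto)
    then show ?thesis using sp assms(1) A by (simp add: kern_def)
  next
    case False
    then have "b A B = 0" if "B \<in> C" for B
      using comps_b[of "comp A" C A B] A' assms(2) that by auto
    then show ?thesis using sp by simp
  qed
qed

lemma kfree_empty: "kfree {}"
  by (auto simp: kfree_def)

section \<open>Ranks of the components and of the whole family\<close>

lemma rk_obtain:
  assumes "C \<in> comps"
  obtains S where "S \<subseteq> C" "kfree S" "card S = rk C"
proof -
  have "finite {S. S \<subseteq> C \<and> kfree S}" using comps_finite[OF assms] by simp
  then have "rk C \<in> card ` {S. S \<subseteq> C \<and> kfree S}"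
    unfolding rk_def using kfree_empty by (intro Max_in) auto
  then show ?thesis using that by auto
qed

lemma rk_ge: "C \<in> comps \<Longrightarrow> S \<subseteq> C \<Longrightarrow> kfree S \<Longrightarrow> card S \<le> rk C"
  unfolding rk_def using comps_finite by (intro Max_ge) auto

lemma rk_less_kern:
  assumes "C \<in> comps" "S \<subseteq> C" "rk C < card S"
  obtains k where "kern k" "\<And>A. A \<notin> S \<Longrightarrow> k A = 0" "\<exists>A\<in>S. k A \<noteq> 0"
proof -
  have "\<not> kfree S" using rk_ge[OF assms(1,2)] assms(3) by (meson not_le)
  then obtain k where k: "kern k" "\<forall>A. A \<notin> S \<longrightarrow> k A = 0" "\<not> (\<forall>A. k A = 0)"
    unfolding kfree_def by blast
  then have e: "\<exists>A\<in>S. k A \<noteq> 0" by blast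
  show ?thesis
  proof (rule that[of k])
    show "k A = 0" if "A \<notin> S" for A using k(2) that by blast
  qed (use k e in blast)+
qed

text \<open>Maximal independent column sets of the blocks are jointly independent, since a kernel
  vector restricts to a kernel vector on each component.\<close>

lemma sum_rk:
  obtains S where "S \<subseteq> Fam" "kfree S" "card S = (\<Sum>C\<in>comps. rk C)"
proof -
  have "\<forall>C\<in>comps. \<exists>S. S \<subseteq> C \<and> kfree S \<and> card S = rk C" using rk_obtain by metis
  then obtain f where f: "\<And>C. C \<in> comps \<Longrightarrow> f C \<subseteq> C \<and> kfree (f C) \<and> card (f C) = rk C" by metis
  let ?S = "\<Union>C\<in>comps. f C"
  have "?S \<subseteq> Fam" using f comps_subset by blast
  moreover have "kfree ?S"
    unfolding kfree_def
  proof (intro allI impI)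
    fix k A assume k: "kern k" and z: "\<forall>A. A \<notin> ?S \<longrightarrow> k A = 0"
    show "k A = 0"
    proof (cases "A \<in> Fam")
      case True
      let ?C = "comp A"
      have C: "?C \<in> comps" using True by (simp add: comps_def)
      let ?k = "\<lambda>A. if A \<in> ?C then k A else 0"
      have "kern ?k" using k C by (rule kern_restrict)
      moreover have "?k B = 0" if "B \<notin> f ?C" for B
      proof (cases "B \<in> ?C")
        case True
        have "B \<notin> f C'" if "C' \<in> comps" for C'
          using f[OF that] comps_disjoint[OF C that] True \<open>B \<notin> f ?C\<close> by blast
        then show ?thesis using z by auto
      qed simp
      ultimately have "?k A = 0" using f[OF C] unfolding kfree_def by blast
      then show ?thesis using comp_self by simp
    next
      case False
      then show ?thesis using k by (rule kern_outside[rotated])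
    qed
  qed
  moreover have "card ?S = (\<Sum>C\<in>comps. card (f C))"
  proof (rule card_UN_disjoint)
    show "\<forall>C\<in>comps. finite (f C)" using f comps_finite finite_subset by blast
    show "\<forall>C\<in>comps. \<forall>C'\<in>comps. C \<noteq> C' \<longrightarrow> f C \<inter> f C' = {}" using f comps_disjoint by blast
  qed (rule finite_comps)
  ultimately show ?thesis using that f by simp
qed

lemma sum_rk_le: "(\<Sum>C\<in>comps. rk C) \<le> n + 1"
  using sum_rk rank_le by metis

lemma sum_rk_le_center: "center u \<Longrightarrow> (\<Sum>C\<in>comps. rk C) \<le> n"
  using sum_rk rank_le_center by metis

lemma sum_rk_le_center_pos: "center u \<Longrightarrow> l > 0 \<Longrightarrow> (\<Sum>C\<in>comps. rk C) + 1 \<le> n"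
  using sum_rk rank_le_center_pos by metis

section \<open>Propagation of zeros and lower bounds for the rank\<close>

lemma kern_row_two:
  assumes "kern k" "A \<in> Fam" "B \<in> Fam" "D \<in> Fam" "A \<noteq> B" "A \<noteq> D" "B \<noteq> D" "{E. adj A E} \<subseteq> {B, D}"
  shows "k A * b A A + k B * b A B + k D * b A D = 0"
  using kern_row[of k A "{B, D}"] assms by auto

text \<open>The row of a vertex involves only that vertex and its at most two neighbours, so two zeros among
  them force the third.\<close>

lemma kern_propagate:
  assumes "kern k" "A \<in> Fam" "k A = 0" "\<exists>B. {E. adj A E} \<subseteq> {B} \<or> (adj A B \<and> k B = 0)" "D \<in> comp A"
  shows "k D = 0"
proof -
  have A: "k A = 0 \<and> (\<exists>B. {E. adj A E} \<subseteq> {B} \<or> (adj A B \<and> k B = 0))" using assms by blast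
  have "adj\<^sup>*\<^sup>* A D" using assms by (simp add: comp_def)
  \<comment> \<open>The condition on \<open>A\<close> travels along the path: after a step from
    \<open>D\<close> to \<open>G\<close>, the vertex \<open>D\<close> is a neighbour of
    \<open>G\<close> with value zero.\<close>
  then have "k D = 0 \<and> (\<exists>B. {E. adj D E} \<subseteq> {B} \<or> (adj D B \<and> k B = 0))"
  proof (induction rule: rtranclp_induct)
    case base
    show ?case by (rule A)
  next
    case (step D G)
    have DG: "D \<in> Fam" "G \<in> Fam" "D \<noteq> G" "b D G \<noteq> 0" using step.hyps by (auto simp: adj_def)
    have "k G = 0"
    proof -
      obtain B where B: "{E. adj D E} \<subseteq> {B} \<or> (adj D B \<and> k B = 0)" using step.IH by blast
      show ?thesis
      proof (cases "B = G")
        case True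
        show ?thesis
        proof (cases "k G = 0")
          case False
          then have "{E. adj D E} \<subseteq> {G}" using B True by blast
          then have "k D * b D D + (\<Sum>B\<in>{G}. k B * b D B) = 0"
            using DG assms(1) by (intro kern_row) auto
          then show ?thesis using step.IH DG by simp
        qed
      next
        case False
        then have B': "adj D B" "k B = 0" using B step.hyps by auto
        have "{E. adj D E} = {B, G}" using adj_two[OF B'(1) step.hyps(2)] False by simp
        then have "k D * b D D + k B * b D B + k G * b D G = 0"
          using DG B' False assms(1) by (intro kern_row_two) (auto simp: adj_def)
        then show ?thesis using step.IH DG B' by simp
      qed
    qed
    moreover have "adj G D" using step.hyps adj_commute by blast
    ultimately show ?case using step.IH by blast
  qed
  then show ?thesis ..
qed

lemma kern_adjacent_zeros:
  assumes "C \<in> comps" "kern k" "A \<in> C" "adj A B" "k A = 0" "k B = 0" "D \<in> C"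
  shows "k D = 0"
  using kern_propagate[of k A D] assms comps_eq[of C A] comps_subset by blast

text \<open>A kernel vector supported off the ends of an edge has two adjacent zeros, hence
  vanishes.\<close>

lemma rk_ge_edge:
  assumes "C \<in> comps" "A \<in> C" "adj A B"
  shows "card C \<le> rk C + 2"
proof -
  have B: "B \<in> C" using assms comps_adj by blast
  have "A \<noteq> B" using assms by (simp add: adj_def)
  have "kfree (C - {A, B})"
    unfolding kfree_def
  proof (intro allI impI)
    fix k D assume k: "kern k" "\<forall>D. D \<notin> C - {A, B} \<longrightarrow> k D = 0"
    then have "k A = 0" "k B = 0" by auto
    then show "k D = 0" using kern_adjacent_zeros[OF assms(1) k(1) assms(2,3)] k(2) by blast
  qed
  then have "card (C - {A, B}) \<le> rk C" using assms by (intro rk_ge) auto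
  moreover have "card (C - {A, B}) = card C - 2"
    using assms B \<open>A \<noteq> B\<close> comps_finite by (subst card_Diff_subset) auto
  ultimately show ?thesis by simp
qed

text \<open>From a vertex with at most one neighbour a single zero already propagates.\<close>

lemma rk_ge_leaf:
  assumes "C \<in> comps" "A \<in> C" "{E. adj A E} \<subseteq> {B}"
  shows "card C \<le> rk C + 1"
proof -
  have "kfree (C - {A})"
    unfolding kfree_def
  proof (intro allI impI)
    fix k D assume k: "kern k" "\<forall>D. D \<notin> C - {A} \<longrightarrow> k D = 0"
    then have "k A = 0" by auto
    then have "k D = 0" if "D \<in> C"
      using kern_propagate[of k A D] assms that k comps_eq[of C A] comps_subset by blast
    then show "k D = 0" using k(2) by blast
  qed
  then have "card (C - {A}) \<le> rk C" using assms by (intro rk_ge) auto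
  then show ?thesis using assms comps_finite by simp
qed

lemma degree_two:
  assumes "C \<in> comps" "A \<in> C" "rk C + 1 < card C"
  obtains B D where "B \<noteq> D" "adj A B" "adj A D" "{E. adj A E} = {B, D}"
proof -
  have "\<nexists>B. {E. adj A E} \<subseteq> {B}" using rk_ge_leaf[OF assms(1,2)] assms(3) by (meson not_le)
  then obtain B where B: "adj A B" by blast
  then obtain D where "adj A D" "D \<noteq> B" using \<open>\<nexists>B. {E. adj A E} \<subseteq> {B}\<close> by blast
  then show ?thesis using that B adj_two by metis
qed

lemma kern_sum_support:
  fixes k f :: "nat set \<Rightarrow> real"
  assumes "S \<subseteq> Fam" "\<And>A. A \<notin> S \<Longrightarrow> k A = 0"
  shows "(\<Sum>B\<in>Fam. k B * f B) = (\<Sum>B\<in>S. k B * f B)"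
  by (rule sum.mono_neutral_right) (use assms finite_Fam in auto)

lemma kern_sum_support':
  fixes k :: "nat set \<Rightarrow> real"
  assumes "S \<subseteq> Fam" "\<And>A. A \<notin> S \<Longrightarrow> k A = 0"
  shows "(\<Sum>B\<in>Fam. k B) = (\<Sum>B\<in>S. k B)"
  using kern_sum_support[OF assms, where f = "\<lambda>_. 1"] by simp

lemma kern_affine:
  assumes "kern k" "S \<subseteq> Fam" "\<And>A. A \<notin> S \<Longrightarrow> k A = 0" "(\<Sum>B\<in>S. k B) = 0"
  shows "(\<Sum>B\<in>S. k B * ind B e) = 0"
  using kern_zero_sum[OF assms(1)] kern_sum_support[OF assms(2,3)] kern_sum_support'[OF assms(2,3)] assms(4)
  by simp

lemma kern_center_support:
  assumes "center u" "kern k" "S \<subseteq> Fam" "\<And>A. A \<notin> S \<Longrightarrow> k A = 0"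
  shows "(\<Sum>B\<in>S. k B * ind B e) = (\<Sum>B\<in>S. k B) * u e"
  using kern_span[OF assms(1,2)] kern_sum_support[OF assms(3,4)] kern_sum_support'[OF assms(3,4)]
  by simp

text \<open>A zero sum would be an affine dependency of distinct 0/1-vectors; the same argument
  serves for three sets.\<close>

lemma kern_two_sum:
  assumes "kern k" "A \<in> Fam" "B \<in> Fam" "A \<noteq> B" "\<And>D. D \<notin> {A, B} \<Longrightarrow> k D = 0" "\<exists>D\<in>{A, B}. k D \<noteq> 0"
  shows "k A + k B \<noteq> 0"
proof
  assume s: "k A + k B = 0"
  have "k A * ind A e + k B * ind B e = 0" for e
    using kern_affine[of k "{A, B}" e] assms s by simp
  from affine_relation_two[OF this s assms(4)] show False using assms(6) by auto
qed

lemma kern_three_sum: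
  assumes "kern k" "A \<in> Fam" "B \<in> Fam" "D \<in> Fam" "A \<noteq> B" "A \<noteq> D" "B \<noteq> D"
    "\<And>E. E \<notin> {A, B, D} \<Longrightarrow> k E = 0" "\<exists>E\<in>{A, B, D}. k E \<noteq> 0"
  shows "k A + k B + k D \<noteq> 0"
proof
  assume s: "k A + k B + k D = 0"
  have "k A * ind A e + k B * ind B e + k D * ind D e = 0" for e
    using kern_affine[of k "{A, B, D}" e] assms s by (simp add: add.assoc)
  from affine_relation_three[OF this s assms(5-7)] show False using assms(9) by auto
qed

text \<open>With rank at most 1 the component is a triangle, and \<open>{A, B}\<close> and
  \<open>{A, D}\<close> both carry kernel vectors. Each expresses \<open>u\<close>; comparing them
  gives an affine relation of three sets, which kills \<open>k B\<close>, and then the row of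
  \<open>D\<close> kills \<open>k A\<close>.\<close>

lemma rk_three:
  assumes C: "C \<in> comps" "card C = 3"
  shows "2 \<le> rk C"
proof (rule ccontr)
  assume r: "\<not> 2 \<le> rk C"
  obtain A B D where ABD: "C = {A, B, D}" "A \<noteq> B" "A \<noteq> D" "B \<noteq> D" using C(2) by (auto simp: card_3_iff)
  have F: "A \<in> Fam" "B \<in> Fam" "D \<in> Fam" using comps_subset[OF C(1)] ABD by auto
  obtain X Y where XY: "X \<noteq> Y" "adj D X" "adj D Y" "{E. adj D E} = {X, Y}"
    using degree_two[of C D] C r ABD by auto
  have "D \<in> C" using ABD by simp
  then have "X \<in> C" "Y \<in> C" using comps_adj[OF C(1)] XY(2,3) by auto
  moreover have "X \<noteq> D" "Y \<noteq> D" using XY by (auto simp: adj_def)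
  ultimately have D: "adj D A" "adj D B" "{E. adj D E} = {A, B}" using XY ABD by auto
  obtain k where k: "kern k" "\<And>E. E \<notin> {A, B} \<Longrightarrow> k E = 0" "\<exists>E\<in>{A, B}. k E \<noteq> 0"
    using rk_less_kern[of C "{A, B}"] C r ABD by auto
  obtain k' where k': "kern k'" "\<And>E. E \<notin> {A, D} \<Longrightarrow> k' E = 0" "\<exists>E\<in>{A, D}. k' E \<noteq> 0"
    using rk_less_kern[of C "{A, D}"] C r ABD by auto
  have s: "k A + k B \<noteq> 0" using kern_two_sum[of k A B] k F ABD by blast
  have s': "k' A + k' D \<noteq> 0" using kern_two_sum[of k' A D] k' F ABD by blast
  have "(\<Sum>B\<in>Fam. k B) = k A + k B" using kern_sum_support'[of "{A, B}" k] k F ABD by auto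
  then obtain u where u: "center u" using kern_center[OF k(1)] s by auto
  have e: "k A * ind A e + k B * ind B e = (k A + k B) * u e" for e
    using kern_center_support[OF u k(1), of "{A, B}" e] k(2) F ABD by auto
  have e': "k' A * ind A e + k' D * ind D e = (k' A + k' D) * u e" for e
    using kern_center_support[OF u k'(1), of "{A, D}" e] k'(2) F ABD by auto
  have "((k' A + k' D) * k A - (k A + k B) * k' A) * ind A e + ((k' A + k' D) * k B) * ind B e
      + (- (k A + k B) * k' D) * ind D e = 0" for e
  proof -
    have "(k' A + k' D) * (k A * ind A e + k B * ind B e) = (k A + k B) * (k' A * ind A e + k' D * ind D e)"
      unfolding e e' by simp
    then show ?thesis by (simp add: algebra_simps)
  qed
  from affine_relation_three[OF this] ABD have "(k' A + k' D) * k B = 0"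
    by (simp add: algebra_simps)
  then have kB: "k B = 0" using s' by simp
  have "k D * b D D + k A * b D A + k B * b D B = 0"
    using k(1) F ABD D(3) by (intro kern_row_two) auto
  then have "k A = 0" using kB k(2)[of D] ABD D(1) by (auto simp: adj_def)
  then show False using kB s by simp
qed

lemma comps_edge:
  assumes "C \<in> comps" "2 \<le> card C"
  obtains A B where "A \<in> C" "adj A B"
proof -
  obtain A where A: "A \<in> C" using comps_nonempty[OF assms(1)] by blast
  have "\<not> C \<subseteq> {A}" using assms(2) card_mono[of "{A}" C] by auto
  then obtain B where "B \<in> C" "B \<noteq> A" by blast
  then have "adj\<^sup>*\<^sup>* A B" "B \<noteq> A" using comps_eq[OF assms(1) A] by (auto simp: comp_def)
  then obtain D where "adj A D" by (metis converse_rtranclpE)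
  then show ?thesis using that A by blast
qed

section \<open>Bad components and the existence of the center\<close>

definition bad :: "nat set set \<Rightarrow> bool" where
  "bad C \<longleftrightarrow> C \<in> comps \<and> \<not> 2 * card C \<le> 3 * rk C"

text \<open>\<open>rk_ge_edge\<close> gives \<open>card C \<le> rk C + 2\<close>, which leaves only
  sizes below six; \<open>rk_ge_leaf\<close> settles size two and \<open>rk_three\<close> excludes
  size three.\<close>

lemma bad_cases:
  assumes "bad C"
  shows "(card C = 1 \<and> rk C = 0) \<or> (card C = 2 \<and> rk C = 1) \<or> (card C = 4 \<and> rk C = 2) \<or> (card C = 5 \<and> rk C = 3)"
proof -
  have C: "C \<in> comps" and r: "\<not> 2 * card C \<le> 3 * rk C" using assms by (auto simp: bad_def)
  have "card C \<noteq> 0" using comps_nonempty[OF C] comps_finite[OF C] by auto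
  then consider "card C = 1" | "card C = 2" | "card C = 3" | "card C \<ge> 4" by linarith
  then show ?thesis
  proof cases
    case 1 then show ?thesis using r by auto
  next
    case 2
    obtain A where A: "A \<in> C" using comps_nonempty[OF C] by blast
    then have "card (C - {A}) = 1" using 2 by simp
    then obtain B where "C - {A} = {B}" by (auto simp: card_1_singleton_iff)
    then have "{E. adj A E} \<subseteq> {B}" using comps_adj[OF C A] by (auto simp: adj_def)
    then have "card C \<le> rk C + 1" using rk_ge_leaf C A by blast
    then show ?thesis using 2 r by auto
  next
    case 3 then show ?thesis using rk_three[OF C] r by auto
  next
    case 4
    then obtain A B where "A \<in> C" "adj A B" using comps_edge[OF C] by auto
    then have "card C \<le> rk C + 2" using rk_ge_edge C by blast
    then show ?thesis using 4 r by auto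
  qed
qed

text \<open>The rank leaves kernel vectors on so few members that a zero sum contradicts affine
  independence: at most three sets or, for size five, two quadruples sharing three sets.\<close>

lemma bad_kern:
  assumes "bad C"
  shows "\<exists>k. kern k \<and> (\<forall>A. A \<notin> C \<longrightarrow> k A = 0) \<and> (\<Sum>A\<in>C. k A) \<noteq> 0"
proof -
  have C: "C \<in> comps" using assms by (simp add: bad_def)
  note F = comps_subset[OF C]
  from bad_cases[OF assms] show ?thesis
  proof (elim disjE conjE)
    assume c: "card C = 1" "rk C = 0"
    then obtain A where A: "C = {A}" by (auto simp: card_1_singleton_iff)
    obtain k where k: "kern k" "\<And>E. E \<notin> C \<Longrightarrow> k E = 0" "\<exists>E\<in>C. k E \<noteq> 0"
      using rk_less_kern[OF C, of C] c by auto
    then have "(\<Sum>A\<in>C. k A) \<noteq> 0" using A by simp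
    then show ?thesis using k by blast
  next
    assume c: "card C = 2" "rk C = 1"
    then obtain A B where A: "C = {A, B}" "A \<noteq> B" by (auto simp: card_2_iff)
    obtain k where k: "kern k" "\<And>E. E \<notin> C \<Longrightarrow> k E = 0" "\<exists>E\<in>C. k E \<noteq> 0"
      using rk_less_kern[OF C, of C] c by auto
    have "k A + k B \<noteq> 0" using kern_two_sum[of k A B] k A F by auto
    then have "(\<Sum>A\<in>C. k A) \<noteq> 0" using A by simp
    then show ?thesis using k by blast
  next
    assume c: "card C = 4" "rk C = 2"
    then obtain A B D E where A: "C = {A, B, D, E}" "distinct [A, B, D, E]" using card_4E by metis
    obtain k where k: "kern k" "\<And>X. X \<notin> {A, B, D} \<Longrightarrow> k X = 0" "\<exists>X\<in>{A, B, D}. k X \<noteq> 0"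
      using rk_less_kern[OF C, of "{A, B, D}"] c A by auto
    have s: "k A + k B + k D \<noteq> 0" using kern_three_sum[of k A B D] k A F by auto
    have "k E = 0" using k(2)[of E] A by auto
    then have "(\<Sum>A\<in>C. k A) \<noteq> 0" using A s by (simp add: add.assoc)
    moreover have "\<forall>X. X \<notin> C \<longrightarrow> k X = 0" using k(2) A by blast
    ultimately show ?thesis using k(1) by blast
  next
    assume c: "card C = 5" "rk C = 3"
    then obtain A B D E G where A: "C = {A, B, D, E, G}" "distinct [A, B, D, E, G]" using card_5E by metis
    have r: "{A, B, D, E} \<subseteq> C" "rk C < card {A, B, D, E}" "{A, B, D, G} \<subseteq> C" "rk C < card {A, B, D, G}"
      using c A by auto
    obtain k where k: "kern k" "\<And>X. X \<notin> {A, B, D, E} \<Longrightarrow> k X = 0" "\<exists>X\<in>{A, B, D, E}. k X \<noteq> 0"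
      using rk_less_kern[OF C r(1,2)] by blast
    obtain k' where k': "kern k'" "\<And>X. X \<notin> {A, B, D, G} \<Longrightarrow> k' X = 0" "\<exists>X\<in>{A, B, D, G}. k' X \<noteq> 0"
      using rk_less_kern[OF C r(3,4)] by blast
    have S: "{A, B, D, E} \<subseteq> Fam" "{A, B, D, G} \<subseteq> Fam" using A F by auto
    have s: "(\<Sum>X\<in>{A, B, D, E}. f X) = f A + f B + f D + f E"
      "(\<Sum>X\<in>{A, B, D, G}. f X) = f A + f B + f D + f G" for f :: "nat set \<Rightarrow> real"
      using A(2) by (simp_all add: add.assoc)
    have z: "k G = 0" by (rule k(2)) (use A(2) in auto)
    have z': "k' E = 0" by (rule k'(2)) (use A(2) in auto)
    have sC: "(\<Sum>X\<in>C. k X) = k A + k B + k D + k E" "(\<Sum>X\<in>C. k' X) = k' A + k' B + k' D + k' G"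
      unfolding A(1) using A(2) z z' by (simp_all add: add.assoc)
    have "X \<notin> {A, B, D, E}" "X \<notin> {A, B, D, G}" if "X \<notin> C" for X using that r(1,3) by blast+
    then have o: "\<forall>X. X \<notin> C \<longrightarrow> k X = 0" "\<forall>X. X \<notin> C \<longrightarrow> k' X = 0"
      using k(2) k'(2) by simp_all
    show ?thesis
    proof (rule ccontr)
      assume no: "\<not> ?thesis"
      have "(\<Sum>X\<in>C. k X) = 0" "(\<Sum>X\<in>C. k' X) = 0" using no k(1) k'(1) o by blast+
      then have s0: "k A + k B + k D + k E = 0" "k' A + k' B + k' D + k' G = 0" using sC by auto
      have "k A * ind A e + k B * ind B e + k D * ind D e + k E * ind E e = 0" for e
      proof -
        have "(\<Sum>X\<in>{A, B, D, E}. k X * ind X e) = 0"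
        proof (rule kern_affine[OF k(1) S(1)])
          show "(\<Sum>X\<in>{A, B, D, E}. k X) = 0" unfolding s s0 ..
        qed (rule k(2))
        then show ?thesis unfolding s .
      qed
      moreover have "k' A * ind A e + k' B * ind B e + k' D * ind D e + k' G * ind G e = 0" for e
      proof -
        have "(\<Sum>X\<in>{A, B, D, G}. k' X * ind X e) = 0"
        proof (rule kern_affine[OF k'(1) S(2)])
          show "(\<Sum>X\<in>{A, B, D, G}. k' X) = 0" unfolding s s0 ..
        qed (rule k'(2))
        then show ?thesis unfolding s .
      qed
      moreover have "\<not> (k A = 0 \<and> k B = 0 \<and> k D = 0 \<and> k E = 0)" using k(3) by blast
      moreover have "\<not> (k' A = 0 \<and> k' B = 0 \<and> k' D = 0 \<and> k' G = 0)" using k'(3) by blast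
      ultimately show False
        using affine_relations_five[OF _ s0(1) _ _ s0(2) _ A(2)] by blast
    qed
  qed
qed

lemma bad_center:
  assumes "bad C"
  shows "\<exists>u. center u"
proof -
  have C: "C \<subseteq> Fam" using assms comps_subset by (simp add: bad_def)
  obtain k where k: "kern k" "\<forall>A. A \<notin> C \<longrightarrow> k A = 0" "(\<Sum>A\<in>C. k A) \<noteq> 0"
    using bad_kern[OF assms] by blast
  have "(\<Sum>A\<in>Fam. k A) = (\<Sum>A\<in>C. k A)" using kern_sum_support'[OF C] k(2) by blast
  then show ?thesis using kern_center[OF k(1)] k(3) by simp
qed

end

section \<open>Components of defective rank\<close>

locale centered_family = fisher_family +
  fixes u :: "nat \<Rightarrow> real"
  assumes center: "center u"
begin

text \<open>\<open>u\<close> leaves {0, 1/2, 1} exactly where \<open>A\<close> and \<open>B\<close>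
  differ, and there \<open>u - 1 / 2\<close> is a multiple of \<open>ind A - ind B\<close>; this
  ties the pair to \<open>u\<close>.\<close>

definition odd_comp :: "nat set set \<Rightarrow> bool" where
  "odd_comp C \<longleftrightarrow> (\<exists>A\<in>C. \<exists>B\<in>C. \<exists>\<beta>. A \<noteq> B \<and> \<beta> \<noteq> 0 \<and> \<beta> \<noteq> 1 \<and> \<beta> \<noteq> 1 / 2 \<and>
     (\<forall>e. (e \<in> A \<and> e \<notin> B \<longrightarrow> u e = \<beta>) \<and> (e \<in> B \<and> e \<notin> A \<longrightarrow> u e = 1 - \<beta>) \<and>
          ((e \<in> A \<longleftrightarrow> e \<in> B) \<longrightarrow> u e \<in> {0, 1, 1 / 2})))"

definition half_comp :: "nat set set \<Rightarrow> bool" where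
  "half_comp C \<longleftrightarrow> (\<exists>A\<in>C. \<exists>B\<in>C. A \<noteq> B \<and> (\<forall>e. u e = (ind A e + ind B e) / 2))"

lemma ip_u: "ip u u = real l" "A \<in> Fam \<Longrightarrow> ip u (ind A) = real l" "A \<in> Fam \<Longrightarrow> ip (ind A) u = real l"
  using center ip_commute[of u "ind A"] by (auto simp: center_def)

lemma u_outside: "e \<notin> {1..n} \<Longrightarrow> u e = 0"
  using center unfolding center_def by blast

section \<open>Bad components with one or two members\<close>

text \<open>\<open>b A A\<close> is the squared distance of \<open>ind A\<close> from
  \<open>u\<close>.\<close>

lemma diag_zero:
  assumes "A \<in> Fam" "b A A = 0"
  shows "ind A e = u e"
proof (cases "e \<in> {1..n}")
  case True
  have "ip (\<lambda>e. ind A e - u e) (\<lambda>e. ind A e - u e)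
      = ip (ind A) (\<lambda>e. ind A e - u e) - ip u (\<lambda>e. ind A e - u e)" by (rule ip_diff)
  also have "ip (ind A) (\<lambda>e. ind A e - u e) = b A A"
    using ip_center_diff(1)[OF center assms(1) assms(1)] by (simp add: ip_commute)
  also have "ip u (\<lambda>e. ind A e - u e) = 0"
    using ip_center_diff(2)[OF center assms(1) assms(1)] by (simp add: ip_commute)
  finally show ?thesis using ip_self_eq_0[OF _ True, of "\<lambda>e. ind A e - u e"] assms by simp
next
  case False
  then show ?thesis using ind_outside[OF assms(1)] u_outside by simp
qed

lemma ind_center_b:
  assumes "A \<in> Fam" "B \<in> Fam" "\<And>e. ind A e = u e"
  shows "b A B = 0"
proof -
  have "ind A = u" using assms(3) by (rule ext)
  then have "ip (ind A) (ind B) = real l" using ip_u(2)[OF assms(2)] by simp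
  then show ?thesis using ip_ind[OF assms(1)] by (simp add: b_def)
qed

lemma adj_diag: "adj A B \<Longrightarrow> b A A \<noteq> 0"
proof
  assume a: "adj A B" and z: "b A A = 0"
  then have F: "A \<in> Fam" "B \<in> Fam" "b A B \<noteq> 0" by (simp_all add: adj_def)
  show False using ind_center_b[OF F(1,2) diag_zero[OF F(1) z]] F(3) by simp
qed

lemma bad_one:
  assumes "bad C" "card C = 1"
  obtains A where "C = {A}" "\<And>e. ind A e = u e"
proof -
  obtain A where A: "C = {A}" using assms(2) by (auto simp: card_1_singleton_iff)
  obtain k where k: "kern k" "\<forall>A. A \<notin> C \<longrightarrow> k A = 0" "(\<Sum>A\<in>C. k A) \<noteq> 0"
    using bad_kern[OF assms(1)] by blast
  have C: "C \<subseteq> Fam" using assms(1) comps_subset by (simp add: bad_def)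
  have "k A * ind A e = k A * u e" for e
    using kern_center_support[OF center k(1) C, of e] k(2) A by simp
  then have "ind A e = u e" for e using k(3) A by simp
  then show ?thesis using that A by blast
qed

text \<open>The kernel vector writes \<open>u\<close> as an affine combination of the two sets; a
  coefficient 0 or 1 would make one of them equal to \<open>u\<close> and hence isolated.\<close>

lemma bad_two:
  assumes "bad C" "card C = 2"
  obtains A B \<alpha> where "C = {A, B}" "A \<noteq> B" "\<alpha> \<noteq> 0" "\<alpha> \<noteq> 1"
    "\<And>e. u e = \<alpha> * ind A e + (1 - \<alpha>) * ind B e"
proof -
  obtain A B where A: "C = {A, B}" "A \<noteq> B" using assms(2) by (auto simp: card_2_iff)
  obtain k where k: "kern k" "\<forall>A. A \<notin> C \<longrightarrow> k A = 0" "(\<Sum>A\<in>C. k A) \<noteq> 0"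
    using bad_kern[OF assms(1)] by blast
  have C: "C \<in> comps" "C \<subseteq> Fam" using assms(1) comps_subset by (auto simp: bad_def)
  have F: "A \<in> Fam" "B \<in> Fam" using C A by auto
  let ?s = "k A + k B"
  have s: "?s \<noteq> 0" using k(3) A by simp
  have r: "k A * ind A e + k B * ind B e = ?s * u e" for e
    using kern_center_support[OF center k(1) C(2), of e] k(2) A by simp
  define \<alpha> where "\<alpha> = k A / ?s"
  have u: "u e = \<alpha> * ind A e + (1 - \<alpha>) * ind B e" for e
  proof -
    have "1 - \<alpha> = k B / ?s" using s by (simp add: \<alpha>_def field_simps)
    then have "\<alpha> * ind A e + (1 - \<alpha>) * ind B e = (k A * ind A e + k B * ind B e) / ?s"
      by (simp add: \<alpha>_def add_divide_distrib)
    also have "\<dots> = u e" unfolding r using s by simp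
    finally show ?thesis by simp
  qed
  obtain X Y where "X \<in> C" "adj X Y" using comps_edge[OF C(1)] assms(2) by auto
  then have "Y \<in> C" "X \<noteq> Y" using comps_adj[OF C(1)] by (auto simp: adj_def)
  then have ad: "b A B \<noteq> 0" using A \<open>X \<in> C\<close> \<open>adj X Y\<close> by (auto simp: adj_def b_commute)
  have "\<alpha> \<noteq> 1" using ind_center_b[OF F] u ad by force
  moreover have "\<alpha> \<noteq> 0" using ind_center_b[OF F(2,1)] u ad b_commute by force
  ultimately show ?thesis using that A u by blast
qed

lemma bad_two_odd_or_half:
  assumes "bad C" "card C = 2"
  shows "odd_comp C \<or> half_comp C"
proof -
  obtain A B \<alpha> where A: "C = {A, B}" "A \<noteq> B" "\<alpha> \<noteq> 0" "\<alpha> \<noteq> 1"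
    "\<And>e. u e = \<alpha> * ind A e + (1 - \<alpha>) * ind B e"
    using bad_two[OF assms] by metis
  show ?thesis
  proof (cases "\<alpha> = 1 / 2")
    case True
    have "\<forall>e. u e = (ind A e + ind B e) / 2" unfolding A(5) True by simp
    then show ?thesis using A(1,2) unfolding half_comp_def by blast
  next
    case False
    have "\<forall>e. (e \<in> A \<and> e \<notin> B \<longrightarrow> u e = \<alpha>) \<and> (e \<in> B \<and> e \<notin> A \<longrightarrow> u e = 1 - \<alpha>) \<and>
          ((e \<in> A \<longleftrightarrow> e \<in> B) \<longrightarrow> u e \<in> {0, 1, 1 / 2})"
      unfolding A(5) by auto
    then show ?thesis using A(1-4) False unfolding odd_comp_def by blast
  qed
qed

text \<open>Sets from different components meet in exactly \<open>l\<close> elements, so the four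
  terms of the expansion cancel.\<close>

lemma ip_comps_zero:
  assumes "C \<in> comps" "C' \<in> comps" "C \<noteq> C'" "A \<in> C" "B \<in> C" "A' \<in> C'" "B' \<in> C'"
  shows "ip (\<lambda>e. ind A e - ind B e) (\<lambda>e. ind A' e - ind B' e) = 0"
proof -
  have F: "A \<in> Fam" "B \<in> Fam" "A' \<in> Fam" "B' \<in> Fam" using assms comps_subset by auto
  have D: "ip (ind D) (\<lambda>e. ind A e - ind B e) = b A D - b B D" for D
    using F by (subst ip_commute) (simp add: ip_diff ip_ind b_def)
  have "ip (\<lambda>e. ind A e - ind B e) (\<lambda>e. ind A' e - ind B' e) = (b A A' - b B A') - (b A B' - b B B')"
    by (subst ip_commute, subst ip_diff) (simp only: D)
  also have "\<dots> = 0" using assms comps_b by simp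
  finally show ?thesis .
qed

lemma ind_diff_nonzero:
  assumes "A \<in> Fam" "B \<in> Fam" "A \<noteq> B"
  shows "\<exists>e\<in>{1..n}. ind A e - ind B e \<noteq> 0"
proof -
  obtain e where "e \<in> A \<longleftrightarrow> e \<notin> B" using assms(3) by auto
  moreover have "A \<union> B \<subseteq> {1..n}" using Fam_subset assms by blast
  ultimately have "e \<in> {1..n}" by blast
  with \<open>e \<in> A \<longleftrightarrow> e \<notin> B\<close> show ?thesis by (intro bexI[of _ e]) auto
qed

text \<open>Both components have a difference vector proportional to \<open>g\<close>, which depends
  on \<open>u\<close> alone; differences from distinct components are orthogonal, so
  \<open>g\<close> would vanish.\<close>

lemma odd_comp_unique:
  assumes "C \<in> comps" "C' \<in> comps" "odd_comp C" "odd_comp C'"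
  shows "C = C'"
proof (rule ccontr)
  assume ne: "C \<noteq> C'"
  define g where "g = (\<lambda>e. if u e \<in> {0, 1, 1 / 2} then 0 else u e - 1 / 2)"
  have rep: "\<exists>A\<in>X. \<exists>B\<in>X. \<exists>c. A \<noteq> B \<and> c \<noteq> 0 \<and> (\<forall>e. g e = c * (ind A e - ind B e))" if "odd_comp X" for X
  proof -
    obtain A B \<beta> where A: "A \<in> X" "B \<in> X" "A \<noteq> B" "\<beta> \<noteq> 0" "\<beta> \<noteq> 1" "\<beta> \<noteq> 1 / 2"
      and e: "\<And>e. (e \<in> A \<and> e \<notin> B \<longrightarrow> u e = \<beta>) \<and> (e \<in> B \<and> e \<notin> A \<longrightarrow> u e = 1 - \<beta>) \<and>
          ((e \<in> A \<longleftrightarrow> e \<in> B) \<longrightarrow> u e \<in> {0, 1, 1 / 2})"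
      using \<open>odd_comp X\<close> unfolding odd_comp_def by blast
    have "g x = (\<beta> - 1 / 2) * (ind A x - ind B x)" for x
      using e[of x] A(4-6) unfolding g_def by (cases "x \<in> A"; cases "x \<in> B") auto
    then show ?thesis using A(1,2,3,6) by (intro bexI[of _ A] bexI[of _ B] exI[of _ "\<beta> - 1 / 2"]) auto
  qed
  obtain A B c where A: "A \<in> C" "B \<in> C" "A \<noteq> B" "c \<noteq> 0" "\<And>e. g e = c * (ind A e - ind B e)"
    using rep[OF assms(3)] by blast
  obtain A' B' c' where A': "A' \<in> C'" "B' \<in> C'" "A' \<noteq> B'" "c' \<noteq> 0" "\<And>e. g e = c' * (ind A' e - ind B' e)"
    using rep[OF assms(4)] by blast
  have g: "g = (\<lambda>e. c * (ind A e - ind B e))" "g = (\<lambda>e. c' * (ind A' e - ind B' e))"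
    using A(5) A'(5) by auto
  have "ip g g = ip (\<lambda>e. c * (ind A e - ind B e)) (\<lambda>e. c' * (ind A' e - ind B' e))"
    using g by metis
  also have "\<dots> = c * (c' * ip (\<lambda>e. ind A e - ind B e) (\<lambda>e. ind A' e - ind B' e))"
    unfolding ip_scale by (subst ip_commute, subst ip_scale, subst ip_commute) simp
  also have "\<dots> = 0" using ip_comps_zero[OF assms(1,2) ne] A A' by simp
  finally have "ip g g = 0" .
  then have "g e = 0" if "e \<in> {1..n}" for e using ip_self_eq_0 that by blast
  moreover obtain e where "e \<in> {1..n}" "ind A e - ind B e \<noteq> 0"
    using ind_diff_nonzero[of A B] A(1-3) assms(1) comps_subset by blast
  ultimately show False using A(4,5) by (metis mult_eq_0_iff)
qed

text \<open>The component is the cycle \<open>A, B, D, E\<close>; a diagonal of the parallelogram is an edge of the cycle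
  here, and joins opposite vertices of the cycle in the next lemma.\<close>

lemma parallelogram_side:
  assumes C: "C \<in> comps" "C = {A, B, D, E}" "distinct [A, B, D, E]"
    and nb: "{X. adj A X} = {B, E}" "{X. adj B X} = {A, D}" "{X. adj D X} = {B, E}" "{X. adj E X} = {A, D}"
    and par: "\<And>e. ind A e + ind B e = ind D e + ind E e"
    and k: "kern k" "k E = 0" "\<And>X. X \<notin> {A, B, D} \<Longrightarrow> k X = 0" "\<exists>X\<in>{A, B, D}. k X \<noteq> 0"
  shows "odd_comp C"
proof -
  have F: "A \<in> Fam" "B \<in> Fam" "D \<in> Fam" "E \<in> Fam" using C comps_subset[OF C(1)] by auto
  have aA: "adj A X \<longleftrightarrow> X = B \<or> X = E" and aB: "adj B X \<longleftrightarrow> X = A \<or> X = D"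
    and aD: "adj D X \<longleftrightarrow> X = B \<or> X = E" for X
    using arg_cong[OF nb(1), of "\<lambda>S. X \<in> S"] arg_cong[OF nb(2), of "\<lambda>S. X \<in> S"]
      arg_cong[OF nb(3), of "\<lambda>S. X \<in> S"] by simp_all
  have AD: "b A D = 0" "b B E = 0" using aA[of D] aB[of E] C(3) F by (auto simp: adj_def)
  have "adj A B" "adj A E" "adj B D" "adj D E" using aA[of B] aA[of E] aB[of D] aD[of E] by simp_all
  then have nz: "b A B \<noteq> 0" "b A E \<noteq> 0" "b B D \<noteq> 0" "b D E \<noteq> 0" by (simp_all add: adj_def)
  have lin: "b A X + b B X = b D X + b E X" for X
  proof -
    have "ip (\<lambda>e. ind A e + ind B e) (ind X) = ip (\<lambda>e. ind D e + ind E e) (ind X)" using par by simp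
    then show ?thesis using F by (simp add: ip_add ip_ind b_def)
  qed
  have "A \<inter> B = D \<inter> E"
  proof (rule set_eqI)
    fix e show "e \<in> A \<inter> B \<longleftrightarrow> e \<in> D \<inter> E" using par[of e]
      by (cases "e \<in> A"; cases "e \<in> B"; cases "e \<in> D"; cases "e \<in> E") auto
  qed
  then have x: "b A B = b D E" by (simp add: b_def)
  have ne: "D \<noteq> B" "E \<noteq> A" "E \<noteq> D" using C(3) by auto
  have row: "k A * b A A + k B * b A B + k E * b A E = 0" "k D * b D D + k B * b D B + k E * b D E = 0"
    "k E * b E E + k A * b E A + k D * b E D = 0"
    using C(3) ne nb kern_row_two[OF k(1) F(1,2,4)] kern_row_two[OF k(1) F(3,2,4)] kern_row_two[OF k(1) F(4,1,3)]
    by simp_all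
  have rA: "k A * b A A + k B * b A B = 0"
    using row(1) k(2) by (simp add: b_commute)
  have rD: "k D * b D D + k B * b B D = 0"
    using row(2) k(2) by (simp add: b_commute)
  have rE: "k A * b A E + k D * b D E = 0"
    using row(3) k(2) by (simp add: b_commute)
  have w: "b A E = b A A + b A B" using lin[of A] AD by (simp add: b_commute)
  have y: "b B D = b D D + b A B" using lin[of D] AD x by (simp add: b_commute)
  \<comment> \<open>The rows of \<open>A\<close> and \<open>E\<close>, rewritten by \<open>w\<close>
    and \<open>x\<close>, show that the middle coefficient is the sum of the outer two, so the total
    is \<open>2 * k B\<close>.\<close>
  have "(k A + k D - k B) * b A B = 0"
    using rA rE unfolding w x[symmetric] by (simp add: algebra_simps)
  then have kB: "k B = k A + k D" using nz by simp
  have sum0: "k A + k B + k D \<noteq> 0" using kern_three_sum[of k A B D] k F C(3) by auto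
  then have kB0: "k B \<noteq> 0" using kB by auto
  have S: "{A, B, D} \<subseteq> Fam" using F by simp
  have u: "k A * ind A e + k B * ind B e + k D * ind D e = 2 * k B * u e" for e
    using kern_center_support[OF center k(1) S k(3), of e] C(3) kB by (simp add: add.assoc)
  \<comment> \<open>In the expression of \<open>u\<close> the coefficients of \<open>A\<close>,
    \<open>B\<close>, \<open>D\<close> are \<open>\<beta>\<close>, \<open>1 / 2\<close>,
    \<open>1 / 2 - \<beta>\<close>. By \<open>par\<close> a point of \<open>A - D\<close> lies
    outside \<open>B\<close> and a point of \<open>D - A\<close> inside, which gives the values
    \<open>\<beta>\<close> and \<open>1 - \<beta>\<close>.\<close>
  define \<beta> where "\<beta> = k A / (2 * k B)"
  have "k A \<noteq> 0" using rA nz kB0 by auto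
  then have "\<beta> \<noteq> 0" using kB0 by (simp add: \<beta>_def)
  moreover have "\<beta> \<noteq> 1"
  proof
    assume "\<beta> = 1"
    then have "k D = - k B" using kB kB0 by (simp add: \<beta>_def field_simps)
    then have "k B * b A B = 0" using rD unfolding y by (simp add: algebra_simps)
    then show False using kB0 nz by simp
  qed
  moreover have "\<beta> \<noteq> 1 / 2"
  proof
    assume "\<beta> = 1 / 2"
    then have "k A = k B" using kB0 by (simp add: \<beta>_def field_simps)
    then have "k B * b A E = 0" using rA unfolding w by (simp add: algebra_simps)
    then show False using kB0 nz by simp
  qed
  moreover have "(e \<in> A \<and> e \<notin> D \<longrightarrow> u e = \<beta>) \<and> (e \<in> D \<and> e \<notin> A \<longrightarrow> u e = 1 - \<beta>) \<and>
          ((e \<in> A \<longleftrightarrow> e \<in> D) \<longrightarrow> u e \<in> {0, 1, 1 / 2})" for e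
  proof -
    have ue: "u e = (k A * ind A e + k B * ind B e + k D * ind D e) / (2 * k B)"
      unfolding u using kB0 by simp
    have kD: "k D = k B - k A" using kB by simp
    show ?thesis
      using par[of e] kB0 unfolding ue \<beta>_def kD
      by (cases "e \<in> A"; cases "e \<in> B"; cases "e \<in> D"; cases "e \<in> E") (auto simp: field_simps)
  qed
  moreover have "A \<in> C" "D \<in> C" "A \<noteq> D" using C(2,3) by auto
  ultimately show ?thesis unfolding odd_comp_def by blast
qed

text \<open>Each diagonal entry of \<open>M\<close> is the sum of the two edge entries in its row,
  and \<open>b X Y \<le> b X X\<close> then makes all edge entries positive. By their rows,
  \<open>k A\<close> and \<open>k D\<close> have the sign opposite to \<open>k B\<close>, against
  the row of \<open>E\<close>.\<close>

lemma parallelogram_diagonal: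
  assumes C: "C \<in> comps" "C = {A, B, D, E}" "distinct [A, B, D, E]"
    and nb: "{X. adj A X} = {B, E}" "{X. adj B X} = {A, D}" "{X. adj D X} = {B, E}" "{X. adj E X} = {A, D}"
    and par: "\<And>e. ind A e + ind D e = ind B e + ind E e"
    and k: "kern k" "k E = 0" "\<And>X. X \<notin> {A, B, D} \<Longrightarrow> k X = 0" "\<exists>X\<in>{A, B, D}. k X \<noteq> 0"
  shows False
proof -
  have F: "A \<in> Fam" "B \<in> Fam" "D \<in> Fam" "E \<in> Fam" using C comps_subset[OF C(1)] by auto
  have aA: "adj A X \<longleftrightarrow> X = B \<or> X = E" and aB: "adj B X \<longleftrightarrow> X = A \<or> X = D"
    and aD: "adj D X \<longleftrightarrow> X = B \<or> X = E" for X
    using arg_cong[OF nb(1), of "\<lambda>S. X \<in> S"] arg_cong[OF nb(2), of "\<lambda>S. X \<in> S"]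
      arg_cong[OF nb(3), of "\<lambda>S. X \<in> S"] by simp_all
  have AD: "b A D = 0" "b B E = 0" using aA[of D] aB[of E] C(3) F by (auto simp: adj_def)
  have "adj A B" "adj A E" "adj B D" "adj D E" using aA[of B] aA[of E] aB[of D] aD[of E] by simp_all
  then have nz: "b A B \<noteq> 0" "b A E \<noteq> 0" "b B D \<noteq> 0" "b D E \<noteq> 0" by (simp_all add: adj_def)
  have lin: "b A X + b D X = b B X + b E X" for X
  proof -
    have "ip (\<lambda>e. ind A e + ind D e) (ind X) = ip (\<lambda>e. ind B e + ind E e) (ind X)" using par by simp
    then show ?thesis using F by (simp add: ip_add ip_ind b_def)
  qed
  have le: "b X Y \<le> b X X" if "X \<in> Fam" for X Y
  proof -
    have "finite X" using Fam_subset[OF that] finite_subset by blast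
    then have "card (X \<inter> Y) \<le> card (X \<inter> X)" by (intro card_mono) auto
    then show ?thesis by (simp add: b_def)
  qed
  have e: "b A A = b A B + b A E" "b B B = b A B + b B D" "b D D = b B D + b D E" "b E E = b A E + b D E"
    using lin[of A] lin[of B] lin[of D] lin[of E] AD by (auto simp: b_commute)
  have pos: "b A B > 0" "b A E > 0" "b B D > 0" "b D E > 0"
  proof -
    have "b A B \<ge> 0" "b A E \<ge> 0" "b B D \<ge> 0" "b D E \<ge> 0"
      using le[OF F(1), of B] le[OF F(1), of E] le[OF F(3), of B] le[OF F(3), of E] e
        b_commute[of D B] by linarith+
    then show "b A B > 0" "b A E > 0" "b B D > 0" "b D E > 0" using nz by (simp_all add: less_le)
  qed
  have ne: "D \<noteq> B" "E \<noteq> A" "E \<noteq> D" using C(3) by auto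
  have row: "k A * b A A + k B * b A B + k E * b A E = 0" "k D * b D D + k B * b D B + k E * b D E = 0"
    "k E * b E E + k A * b E A + k D * b E D = 0"
    using C(3) ne nb kern_row_two[OF k(1) F(1,2,4)] kern_row_two[OF k(1) F(3,2,4)] kern_row_two[OF k(1) F(4,1,3)]
    by simp_all
  have rA: "k A * b A A = - k B * b A B"
    using row(1) k(2) by (simp add: b_commute)
  have rD: "k D * b D D = - k B * b B D"
    using row(2) k(2) by (simp add: b_commute)
  have rE: "k A * b A E + k D * b D E = 0"
    using row(3) k(2) by (simp add: b_commute)
  have p: "b A A > 0" "b D D > 0" using e pos by auto
  \<comment> \<open>The row of \<open>E\<close>, multiplied by both diagonal entries, becomes
    \<open>- k B\<close> times a positive number.\<close>
  have "0 = (k A * b A A) * b A E * b D D + (k D * b D D) * b D E * b A A"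
    using arg_cong[OF rE, of "\<lambda>t. t * b A A * b D D"] by (simp add: algebra_simps)
  also have "\<dots> = - k B * (b A B * b A E * b D D + b B D * b D E * b A A)"
    unfolding rA rD by (simp add: algebra_simps)
  finally have "k B * (b A B * b A E * b D D + b B D * b D E * b A A) = 0" by simp
  moreover have "b A B * b A E * b D D + b B D * b D E * b A A > 0"
    using pos p by (intro add_pos_pos mult_pos_pos)
  ultimately have "k B = 0" by simp
  then have "k A = 0" "k D = 0" using rA rD p by auto
  then show False using k(4) \<open>k B = 0\<close> by auto
qed

text \<open>All degrees are two, so the component is a 4-cycle \<open>A\<close>, \<open>B\<close>,
  \<open>D\<close>, \<open>E\<close>. Rank 2 leaves enough kernel vectors to combine into one with
  zero sum, hence a parallelogram, whose three possible pairings are the cases.\<close>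

lemma bad_four_odd:
  assumes "bad C" "card C = 4"
  shows "odd_comp C"
proof -
  have C: "C \<in> comps" using assms(1) by (simp add: bad_def)
  have r: "rk C = 2" using bad_cases[OF assms(1)] assms(2) by auto
  have deg: "\<exists>Y Z. Y \<noteq> Z \<and> Y \<in> C \<and> Z \<in> C \<and> adj X Y \<and> adj X Z \<and> {W. adj X W} = {Y, Z}"
    if X: "X \<in> C" for X
  proof -
    obtain Y Z where "Y \<noteq> Z" "adj X Y" "adj X Z" "{W. adj X W} = {Y, Z}"
      using degree_two[OF C X] r assms(2) by auto
    then show ?thesis using comps_adj[OF C X] by blast
  qed
  obtain A where A: "A \<in> C" using comps_nonempty[OF C] by blast
  obtain B E where BE: "B \<noteq> E" "B \<in> C" "E \<in> C" "adj A B" "adj A E" "{W. adj A W} = {B, E}"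
    using deg[OF A] by blast
  have ne: "A \<noteq> B" "A \<noteq> E" using BE by (auto simp: adj_def)
  have "card (C - {A, B, E}) = 1" using assms(2) A BE ne comps_finite[OF C] by (subst card_Diff_subset) auto
  then obtain D where D: "C - {A, B, E} = {D}" by (auto simp: card_1_singleton_iff)
  then have D': "D \<in> C" "D \<notin> {A, B, E}" by blast+
  have dist: "distinct [A, B, D, E]" using D' ne BE(1) by auto
  have CC: "C = {A, B, D, E}" using D A BE(2,3) by blast
  have nDA: "\<not> adj D A"
    using arg_cong[OF BE(6), of "\<lambda>S. D \<in> S"] dist adj_commute[of D A] by auto
  obtain Y Z where YZ: "Y \<noteq> Z" "Y \<in> C" "Z \<in> C" "adj D Y" "adj D Z" "{W. adj D W} = {Y, Z}"
    using deg[OF D'(1)] by blast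
  have "Y \<noteq> D" "Z \<noteq> D" "Y \<noteq> A" "Z \<noteq> A" using YZ(4,5) nDA by (auto simp: adj_def)
  then have "Y \<in> {B, E}" "Z \<in> {B, E}" using YZ(2,3) CC by blast+
  then have nD: "{W. adj D W} = {B, E}" "adj D B" "adj D E" using YZ(1,4-6) by auto
  have nB: "{W. adj B W} = {A, D}"
    using adj_two[of B A D] BE(4) nD(2) adj_commute[of A B] adj_commute[of D B] dist by simp
  have nE: "{W. adj E W} = {A, D}"
    using adj_two[of E A D] BE(5) nD(3) adj_commute[of A E] adj_commute[of D E] dist by simp
  have sub: "{A, B, D} \<subseteq> C" "rk C < card {A, B, D}" "{A, D, E} \<subseteq> C" "rk C < card {A, D, E}"
     "{B, D, E} \<subseteq> C" "rk C < card {B, D, E}" using CC r dist by auto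
  have F: "A \<in> Fam" "B \<in> Fam" "D \<in> Fam" "E \<in> Fam" using CC comps_subset[OF C] by auto
  obtain k where k: "kern k" "\<And>X. X \<notin> {A, B, D} \<Longrightarrow> k X = 0" "\<exists>X\<in>{A, B, D}. k X \<noteq> 0"
    using rk_less_kern[OF C sub(1,2)] by blast
  obtain m where m: "kern m" "\<And>X. X \<notin> {A, D, E} \<Longrightarrow> m X = 0" "\<exists>X\<in>{A, D, E}. m X \<noteq> 0"
    using rk_less_kern[OF C sub(3,4)] by blast
  obtain p where p: "kern p" "\<And>X. X \<notin> {B, D, E} \<Longrightarrow> p X = 0" "\<exists>X\<in>{B, D, E}. p X \<noteq> 0"
    using rk_less_kern[OF C sub(5,6)] by blast
  have kE: "k E = 0" using k(2)[of E] dist by auto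
  have mB: "m B = 0" using m(2)[of B] dist by auto
  have pA: "p A = 0" using p(2)[of A] dist by auto
  \<comment> \<open>Otherwise \<open>p\<close> has zeros at both ends of the edge from
    \<open>A\<close> to \<open>E\<close>.\<close>
  have pE: "p E \<noteq> 0"
  proof
    assume z: "p E = 0"
    have "p X = 0" if "X \<in> C" for X
      using kern_adjacent_zeros[OF C p(1) A \<open>adj A E\<close> pA z that] .
    then show False using p(3) CC by auto
  qed
  have sk: "k A + k B + k D \<noteq> 0" using kern_three_sum[of k A B D] k F dist by auto
  define s where "s = k A + k B + k D"
  define t where "t = p B + p D + p E"
  \<comment> \<open>The combination with coefficient sum zero; at \<open>E\<close>, where
    \<open>k\<close> vanishes and \<open>p\<close> does not, it is nonzero.\<close>
  define d where "d = (\<lambda>X. t * k X + (- s) * p X)"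
  have d: "kern d" unfolding d_def by (rule kern_linear[OF k(1) p(1)])
  have dE: "d E \<noteq> 0" using pE kE sk by (simp add: d_def s_def)
  have d0: "\<And>X. X \<notin> C \<Longrightarrow> d X = 0" using k(2) p(2) CC by (auto simp: d_def)
  have ds: "d A + d B + d D + d E = 0" using pA kE by (simp add: d_def s_def t_def algebra_simps)
  have dsC: "(\<Sum>X\<in>C. d X * f X) = d A * f A + d B * f B + d D * f D + d E * f E" for f
    using CC dist by (simp add: add.assoc)
  have "(\<Sum>X\<in>C. d X) = 0" using dsC[of "\<lambda>_. 1"] ds by simp
  then have rel: "d A * ind A e + d B * ind B e + d D * ind D e + d E * ind E e = 0" for e
    using kern_affine[OF d comps_subset[OF C] d0, of e] dsC[of "\<lambda>X. ind X e"] by simp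
  have nzd: "\<not> (d A = 0 \<and> d B = 0 \<and> d D = 0 \<and> d E = 0)" using dE by simp
  have "(\<forall>e. ind A e + ind B e = ind D e + ind E e) \<or>
         (\<forall>e. ind A e + ind D e = ind B e + ind E e) \<or>
         (\<forall>e. ind A e + ind E e = ind B e + ind D e)"
    by (rule affine_relation_four[OF rel ds nzd]) (use dist in auto)
  then show ?thesis
  proof (elim disjE)
    assume "\<forall>e. ind A e + ind B e = ind D e + ind E e"
    then show ?thesis
      using parallelogram_side[OF C CC dist BE(6) nB nD(1) nE _ k(1) kE k(2,3)] by blast
  next
    assume "\<forall>e. ind A e + ind D e = ind B e + ind E e"
    then show ?thesis
      using parallelogram_diagonal[OF C CC dist BE(6) nB nD(1) nE _ k(1) kE k(2,3)] by blast
  next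
    assume "\<forall>e. ind A e + ind E e = ind B e + ind D e"
    \<comment> \<open>Exchanging \<open>B\<close> and \<open>E\<close> reflects the cycle and turns
      this case into the first; \<open>m\<close>, which vanishes at \<open>B\<close>, takes the
      place of \<open>k\<close>.\<close>
    then have par: "\<And>e. ind A e + ind E e = ind D e + ind B e" by (simp add: add.commute)
    have m': "\<And>X. X \<notin> {A, E, D} \<Longrightarrow> m X = 0" "\<exists>X\<in>{A, E, D}. m X \<noteq> 0" using m(2,3) by auto
    have CC': "C = {A, E, D, B}" "distinct [A, E, D, B]" using CC dist by auto
    have n': "{W. adj A W} = {E, B}" "{W. adj D W} = {E, B}" using BE(6) nD(1) by auto
    show ?thesis
      by (rule parallelogram_side[OF C CC' n'(1) nE n'(2) nB par m(1) mB m'])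
  qed
qed

section \<open>Bad components with five members\<close>

lemma five_kern:
  assumes "bad C" "card C = 5" "X \<in> C"
  obtains k where "kern k" "\<And>A. A \<notin> C \<Longrightarrow> k A = 0" "k X = 0" "\<exists>Y\<in>C. k Y \<noteq> 0"
proof -
  have C: "C \<in> comps" using assms(1) by (simp add: bad_def)
  have "rk C < card (C - {X})" using bad_cases[OF assms(1)] assms(2,3) by auto
  then obtain k where k: "kern k" "\<And>A. A \<notin> C - {X} \<Longrightarrow> k A = 0" "\<exists>Y\<in>C - {X}. k Y \<noteq> 0"
    using rk_less_kern[OF C Diff_subset] by blast
  show ?thesis
  proof (rule that[OF k(1)])
    show "k A = 0" if "A \<notin> C" for A by (rule k(2)) (use that in auto)
    show "k X = 0" by (rule k(2)) auto
    show "\<exists>Y\<in>C. k Y \<noteq> 0" using k(3) by blast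
  qed
qed

text \<open>Adjacent zeros propagate. Nonadjacent \<open>X\<close> and \<open>Y\<close> have two
  neighbours each among the three other members, hence a common one, \<open>M\<close>; its row
  leaves \<open>k M * b M M = 0\<close> with nonzero diagonal entry, so \<open>X\<close> and
  \<open>M\<close> are adjacent zeros.\<close>

lemma five_zeros:
  assumes "bad C" "card C = 5" "X \<in> C" "Y \<in> C" "X \<noteq> Y" "kern k" "k X = 0" "k Y = 0" "D \<in> C"
  shows "k D = 0"
proof -
  have C: "C \<in> comps" using assms(1) by (simp add: bad_def)
  have r: "rk C + 1 < card C" using bad_cases[OF assms(1)] assms(2) by auto
  show ?thesis
  proof (cases "adj X Y")
    case True
    then show ?thesis using kern_adjacent_zeros[OF C assms(6,3) _ assms(7,8,9)] by blast
  next
    case False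
    obtain P Q where PQ: "P \<noteq> Q" "adj X P" "adj X Q" using degree_two[OF C assms(3) r] by metis
    obtain R S where RS: "R \<noteq> S" "adj Y R" "adj Y S" using degree_two[OF C assms(4) r] by metis
    have nadj: "\<not> adj Y X" using False adj_commute by blast
    have "P \<in> C" "Q \<in> C" "R \<in> C" "S \<in> C"
      using comps_adj[OF C assms(3)] comps_adj[OF C assms(4)] PQ RS by auto
    moreover have "X \<notin> {P, Q, R, S}" "Y \<notin> {P, Q, R, S}" using PQ RS False nadj by (auto simp: adj_def)
    ultimately have sub: "{P, Q} \<union> {R, S} \<subseteq> C - {X, Y}" by blast
    have "card (C - {X, Y}) = 3"
      using assms(2-5) comps_finite[OF C] by (subst card_Diff_subset) auto
    then have "card ({P, Q} \<union> {R, S}) \<le> 3"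
      using card_mono[OF _ sub] comps_finite[OF C] by simp
    moreover have "card ({P, Q} \<union> {R, S}) = 4" if "{P, Q} \<inter> {R, S} = {}"
      using PQ(1) RS(1) by (subst card_Un_disjoint[OF _ _ that]) simp_all
    ultimately have "{P, Q} \<inter> {R, S} \<noteq> {}" by linarith
    then obtain M where "adj X M" "adj Y M" using PQ RS by blast
    then have M: "adj M X" "adj M Y" "adj X M" using adj_commute by blast+
    have F: "M \<in> Fam" "X \<in> Fam" "Y \<in> Fam" "M \<noteq> X" "M \<noteq> Y" using M by (auto simp: adj_def)
    have "k M * b M M + k X * b M X + k Y * b M Y = 0"
      by (rule kern_row_two[OF assms(6) F(1-3) F(4,5) assms(5)])
        (simp add: adj_two[OF M(1,2) assms(5)])
    then have "k M = 0" using assms(7,8) adj_diag[OF M(1)] by simp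
    then show ?thesis using kern_adjacent_zeros[OF C assms(6,3) M(3) assms(7) _ assms(9)] by blast
  qed
qed

text \<open>A nonzero kernel vector on \<open>C\<close> that vanishes at \<open>Y\<close> is nonzero
  at \<open>Z\<close> by \<open>five_zeros\<close>, so it tests \<open>v\<close> at \<open>Z\<close>
  alone.\<close>

lemma five_sparse:
  fixes v :: "nat set \<Rightarrow> real"
  assumes bad: "bad C" "card C = 5"
    and v: "\<And>k. kern k \<Longrightarrow> (\<And>A. A \<notin> C \<Longrightarrow> k A = 0) \<Longrightarrow> (\<Sum>X\<in>C. k X * v X) = 0"
    and YZ: "Y \<in> C" "Z \<in> C" "Y \<noteq> Z" and z: "\<And>X. X \<in> C \<Longrightarrow> X \<noteq> Y \<Longrightarrow> X \<noteq> Z \<Longrightarrow> v X = 0"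
  shows "v Z = 0"
proof -
  have C: "C \<in> comps" using bad by (simp add: bad_def)
  obtain k where k: "kern k" "\<And>A. A \<notin> C \<Longrightarrow> k A = 0" "k Y = 0" "\<exists>W\<in>C. k W \<noteq> 0"
    using five_kern[OF bad YZ(1)] by metis
  have "(\<Sum>X\<in>C. k X * v X) = (\<Sum>X\<in>{Z}. k X * v X)"
    by (rule sum.mono_neutral_right) (use YZ z k(3) comps_finite[OF C] in auto)
  then have "k Z * v Z = 0" using v[OF k(1,2)] by simp
  moreover have "k Z \<noteq> 0" using five_zeros[OF bad YZ k(1,3)] k(4) by blast
  ultimately show ?thesis by simp
qed

text \<open>At a coordinate where \<open>u\<close> vanishes, the 0/1-column of the five members is
  orthogonal to the kernel, as are differences of such columns. By \<open>five_sparse\<close> the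
  columns form a code as in \<open>code_distance_three\<close>, so two members agree on all of
  them.\<close>

lemma bad_five_pair:
  assumes bad: "bad C" "card C = 5"
  obtains A B where "A \<in> C" "B \<in> C" "A \<noteq> B" "\<And>e. u e = 0 \<Longrightarrow> e \<in> A \<longleftrightarrow> e \<in> B"
proof -
  have C: "C \<in> comps" "C \<subseteq> Fam" using bad comps_subset by (auto simp: bad_def)
  obtain A B D E G where F: "C = {A, B, D, E, G}" "distinct [A, B, D, E, G]"
    using card_5E[OF bad(2)] by metis
  have zero: "(\<Sum>X\<in>C. k X * ind X e) = 0"
    if "kern k" "\<And>A. A \<notin> C \<Longrightarrow> k A = 0" "u e = 0" for k e
    using kern_center_support[OF center that(1) C(2), of e] that(2,3) by simp
  have one: "(of_bool (e \<in> A) + of_bool (e \<in> B) + of_bool (e \<in> D) + of_bool (e \<in> E) + of_bool (e \<in> G) :: nat) \<notin> {1, 2}"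
    if e: "u e = 0" for e
  proof (rule sparse_count[OF F])
    fix Y Z assume YZ: "Y \<in> C" "Z \<in> C" "Y \<noteq> Z" and n: "\<And>X. X \<in> C \<Longrightarrow> X \<noteq> Y \<Longrightarrow> X \<noteq> Z \<Longrightarrow> e \<notin> X"
    have "ind Z e = 0" by (rule five_sparse[OF bad _ YZ, of "\<lambda>X. ind X e"]) (use zero e n in auto)
    then show "e \<notin> Z" by simp
  qed
  have two: "(of_bool ((e \<in> A) \<noteq> (f \<in> A)) + of_bool ((e \<in> B) \<noteq> (f \<in> B)) + of_bool ((e \<in> D) \<noteq> (f \<in> D))
     + of_bool ((e \<in> E) \<noteq> (f \<in> E)) + of_bool ((e \<in> G) \<noteq> (f \<in> G)) :: nat) \<notin> {1, 2}"
    if e: "u e = 0" "u f = 0" for e f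
  proof (rule sparse_count[OF F])
    fix Y Z assume YZ: "Y \<in> C" "Z \<in> C" "Y \<noteq> Z"
      and n: "\<And>X. X \<in> C \<Longrightarrow> X \<noteq> Y \<Longrightarrow> X \<noteq> Z \<Longrightarrow> \<not> (e \<in> X) \<noteq> (f \<in> X)"
    have "ind Z e - ind Z f = 0"
    proof (rule five_sparse[OF bad _ YZ, of "\<lambda>X. ind X e - ind X f"])
      fix k assume "kern k" "\<And>A. A \<notin> C \<Longrightarrow> k A = 0"
      from zero[OF this e(1)] zero[OF this e(2)] show "(\<Sum>X\<in>C. k X * (ind X e - ind X f)) = 0"
        by (simp add: right_diff_distrib sum_subtractf)
    next
      fix X assume "X \<in> C" "X \<noteq> Y" "X \<noteq> Z"
      from n[OF this] show "ind X e - ind X f = 0" by simp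
    qed
    then show "\<not> (e \<in> Z) \<noteq> (f \<in> Z)" by (cases "e \<in> Z"; cases "f \<in> Z") auto
  qed
  define P where "P = (\<lambda>x1 x2 x3 x4 x5. \<exists>e. u e = 0 \<and> x1 = (e \<in> A) \<and> x2 = (e \<in> B) \<and> x3 = (e \<in> D)
      \<and> x4 = (e \<in> E) \<and> x5 = (e \<in> G))"
  have "\<exists>X\<in>C. \<exists>Y\<in>C. X \<noteq> Y \<and> (\<forall>e. u e = 0 \<longrightarrow> (e \<in> X \<longleftrightarrow> e \<in> Y))"
  proof (rule ccontr)
    assume no: "\<not> ?thesis"
    have sep: "\<exists>e. u e = 0 \<and> (e \<in> X) \<noteq> (e \<in> Y)" if "X \<in> C" "Y \<in> C" "X \<noteq> Y" for X Y
      using no that by blast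
    have mem: "A \<in> C" "B \<in> C" "D \<in> C" "E \<in> C" "G \<in> C" using F(1) by auto
    have ex: "\<exists>x1 x2 x3 x4 x5. P x1 x2 x3 x4 x5 \<and> Q x1 x2 x3 x4 x5"
      if "\<exists>e. u e = 0 \<and> Q (e \<in> A) (e \<in> B) (e \<in> D) (e \<in> E) (e \<in> G)" for Q
      using that unfolding P_def by blast
    show False
    proof (rule code_distance_three[of P])
      fix x1 x2 x3 x4 x5 assume "P x1 x2 x3 x4 x5"
      then obtain e where e: "u e = 0" "x1 = (e \<in> A)" "x2 = (e \<in> B)" "x3 = (e \<in> D)" "x4 = (e \<in> E)" "x5 = (e \<in> G)"
        unfolding P_def by blast
      show "(of_bool x1 + of_bool x2 + of_bool x3 + of_bool x4 + of_bool x5 :: nat) \<notin> {1, 2}"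
        unfolding e(2-6) by (rule one[OF e(1)])
      fix y1 y2 y3 y4 y5 assume "P y1 y2 y3 y4 y5"
      then obtain f where f: "u f = 0" "y1 = (f \<in> A)" "y2 = (f \<in> B)" "y3 = (f \<in> D)" "y4 = (f \<in> E)" "y5 = (f \<in> G)"
        unfolding P_def by blast
      show "(of_bool (x1 \<noteq> y1) + of_bool (x2 \<noteq> y2) + of_bool (x3 \<noteq> y3) + of_bool (x4 \<noteq> y4)
        + of_bool (x5 \<noteq> y5) :: nat) \<notin> {1, 2}"
        unfolding e(2-6) f(2-6) by (rule two[OF e(1) f(1)])
    qed (rule ex, rule sep; use mem F(2) in simp)+
  qed
  then show ?thesis using that by blast
qed

text \<open>The differences \<open>ind A - ind B\<close>, one per component, are nonzero, pairwise
  orthogonal and supported on \<open>T\<close>.\<close>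

lemma card_supported_le:
  assumes K: "K \<subseteq> comps" and T: "T \<subseteq> {1..n}"
    and ex: "\<And>C. C \<in> K \<Longrightarrow> \<exists>A\<in>C. \<exists>B\<in>C. A \<noteq> B \<and> (\<forall>e\<in>{1..n}. e \<notin> T \<longrightarrow> (e \<in> A \<longleftrightarrow> e \<in> B))"
  shows "card K \<le> card T"
proof -
  obtain f g where fg: "\<And>C. C \<in> K \<Longrightarrow> f C \<in> C \<and> g C \<in> C \<and> f C \<noteq> g C \<and>
      (\<forall>e\<in>{1..n}. e \<notin> T \<longrightarrow> (e \<in> f C \<longleftrightarrow> e \<in> g C))"
    using ex by metis
  show ?thesis
  proof (rule card_le_of_orthogonal[of "{1..n}" T K "\<lambda>C e. ind (f C) e - ind (g C) e"])
    show "finite K" using K finite_comps finite_subset by blast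
  next
    fix C e assume "C \<in> K" "e \<in> {1..n} - T"
    then have "e \<in> f C \<longleftrightarrow> e \<in> g C" using fg by blast
    then show "ind (f C) e - ind (g C) e = 0" by simp
  next
    fix C C' assume "C \<in> K" "C' \<in> K" "C \<noteq> C'"
    then have "ip (\<lambda>e. ind (f C) e - ind (g C) e) (\<lambda>e. ind (f C') e - ind (g C') e) = 0"
      using ip_comps_zero[of C C'] fg K by blast
    then show "(\<Sum>e\<in>{1..n}. (ind (f C) e - ind (g C) e) * (ind (f C') e - ind (g C') e)) = 0"
      unfolding ip_def .
  next
    fix C assume "C \<in> K"
    then have "f C \<in> Fam" "g C \<in> Fam" "f C \<noteq> g C" using fg K comps_subset by blast+
    then show "\<exists>e\<in>{1..n}. ind (f C) e - ind (g C) e \<noteq> 0" by (rule ind_diff_nonzero)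
  qed (use T in auto)
qed

section \<open>Counting\<close>

definition bads :: "nat \<Rightarrow> nat set set set" where
  "bads c = {C. bad C \<and> card C = c}"

lemma bads_subset: "bads c \<subseteq> comps"
  by (auto simp: bads_def bad_def)

lemma finite_bads: "finite (bads c)"
  using bads_subset finite_comps by (rule finite_subset)

lemma card_bads_one: "card (bads 1) \<le> 1"
proof -
  have "C = C'" if "C \<in> bads 1" "C' \<in> bads 1" for C C'
  proof -
    obtain A where A: "C = {A}" "\<And>e. ind A e = u e"
      using bad_one[of C] \<open>C \<in> bads 1\<close> unfolding bads_def by blast
    obtain A' where A': "C' = {A'}" "\<And>e. ind A' e = u e"
      using bad_one[of C'] \<open>C' \<in> bads 1\<close> unfolding bads_def by blast
    have "e \<in> A \<longleftrightarrow> e \<in> A'" for e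
    proof -
      have "ind A e = ind A' e" using A(2) A'(2) by metis
      then show ?thesis by (cases "e \<in> A"; cases "e \<in> A'") auto
    qed
    then show ?thesis using A(1) A'(1) by blast
  qed
  then show ?thesis using finite_bads by (simp add: card_le_Suc0_iff_eq)
qed

lemma odd_comp_value:
  assumes "odd_comp C"
  shows "\<exists>e. u e \<notin> {0, 1, 1 / 2}"
proof -
  obtain A B \<beta> where A: "A \<noteq> B" "\<beta> \<noteq> 0" "\<beta> \<noteq> 1" "\<beta> \<noteq> 1 / 2"
    and e: "\<forall>e. (e \<in> A \<and> e \<notin> B \<longrightarrow> u e = \<beta>) \<and> (e \<in> B \<and> e \<notin> A \<longrightarrow> u e = 1 - \<beta>) \<and>
          ((e \<in> A \<longleftrightarrow> e \<in> B) \<longrightarrow> u e \<in> {0, 1, 1 / 2})"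
    using assms unfolding odd_comp_def by (elim bexE exE conjE) (rule that)
  obtain e where "e \<in> A \<longleftrightarrow> e \<notin> B" using A(1) by blast
  then have "u e = \<beta> \<or> u e = 1 - \<beta>" using e by blast
  then have "u e \<notin> {0, 1, 1 / 2}" using A(2-4) by auto
  then show ?thesis by blast
qed

text \<open>An odd component needs a value of \<open>u\<close> outside {0, 1/2, 1}, a half component
  the value 1/2.\<close>

lemma zero_one_center:
  assumes "\<And>e. u e \<in> {0, 1}"
  shows "bads 2 = {}" "bads 4 = {}"
proof -
  have "\<not> odd_comp C" for C using odd_comp_value assms by blast
  moreover have "\<not> half_comp C" for C
  proof
    assume "half_comp C"
    then obtain A B where A: "A \<noteq> B" and e: "\<And>e. u e = (ind A e + ind B e) / 2"
      unfolding half_comp_def by blast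
    obtain e where "e \<in> A \<longleftrightarrow> e \<notin> B" using A(1) by blast
    then show False using e[of e] assms[of e] by (cases "e \<in> A") auto
  qed
  ultimately show "bads 2 = {}" "bads 4 = {}"
    using bad_two_odd_or_half bad_four_odd unfolding bads_def by blast+
qed

lemma bads_one_center:
  assumes "bads 1 \<noteq> {}"
  shows "u e \<in> {0, 1}"
proof -
  obtain C where "C \<in> bads 1" using assms by blast
  then obtain A where "\<And>e. ind A e = u e" using bad_one[of C] unfolding bads_def by blast
  then have "u e = ind A e" by simp
  then show ?thesis by (cases "e \<in> A") auto
qed

lemma l_zero_center:
  assumes "l = 0"
  shows "u e \<in> {0, 1}"
  using ip_self_eq_0[of u e] ip_u(1) u_outside[of e] assms by (cases "e \<in> {1..n}") auto

text \<open>A half component confines \<open>u\<close> to {0, 1/2, 1}, so no component is odd and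
  all bad pairs differ only where \<open>u\<close> is 1/2. Otherwise all bad components of size two
  or four are odd, so there is at most one. The weights 1 and 2 are those of
  \<open>comps_estimates\<close>.\<close>

lemma pairs_bound:
  shows "card (bads 2) + 2 * card (bads 4) \<le> 2 \<or>
    (card (bads 2) + 2 * card (bads 4) \<le> 4 * l \<and> 3 * card (bads 2) + 6 * card (bads 4) + 4 * l \<le> 4 * n)"
proof (cases "\<exists>C. half_comp C")
  case True
  then obtain A B where AB: "\<And>e. u e = (ind A e + ind B e) / 2" unfolding half_comp_def by blast
  have val: "u e \<in> {0, 1, 1 / 2}" for e unfolding AB by auto
  have no_odd: "\<not> odd_comp C" for C using odd_comp_value val by blast
  have b4: "bads 4 = {}" using bad_four_odd no_odd unfolding bads_def by blast
  define Y where "Y = {e \<in> {1..n}. u e = 1 / 2}"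
  define X where "X = {e \<in> {1..n}. u e = 1}"
  have "card (bads 2) \<le> card Y"
  proof (rule card_supported_le[OF bads_subset])
    fix C assume "C \<in> bads 2"
    then have "half_comp C" using bad_two_odd_or_half no_odd unfolding bads_def by blast
    then obtain A B where A: "A \<in> C" "B \<in> C" "A \<noteq> B" and e: "\<And>e. u e = (ind A e + ind B e) / 2"
      unfolding half_comp_def by blast
    have "e \<in> A \<longleftrightarrow> e \<in> B" if "e \<in> {1..n}" "e \<notin> Y" for e
    proof -
      have "u e \<noteq> 1 / 2" using that by (simp add: Y_def)
      then show ?thesis unfolding e by (cases "e \<in> A"; cases "e \<in> B") auto
    qed
    then show "\<exists>A\<in>C. \<exists>B\<in>C. A \<noteq> B \<and> (\<forall>e\<in>{1..n}. e \<notin> Y \<longrightarrow> (e \<in> A \<longleftrightarrow> e \<in> B))"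
      using A by blast
  qed (auto simp: Y_def)
  \<comment> \<open>In \<open>ip u u = l\<close> the ones count 1 and the halves 1/4. With
    \<open>card X + card Y \<le> n\<close> this yields \<open>card Y \<le> 4 * l\<close> and
    \<open>3 * card Y + 4 * l \<le> 4 * n\<close>.\<close>
  moreover have XY: "4 * card X + card Y = 4 * l"
  proof -
    have "real l = (\<Sum>e\<in>{1..n}. u e * u e)" using ip_u(1) unfolding ip_def by simp
    also have "\<dots> = (\<Sum>e\<in>{1..n}. of_bool (e \<in> X) + of_bool (e \<in> Y) / 4)"
    proof (rule sum.cong[OF refl])
      fix e assume "e \<in> {1..n}"
      then show "u e * u e = of_bool (e \<in> X) + of_bool (e \<in> Y) / 4"
      proof -
        consider "u e = 0" | "u e = 1" | "u e = 1 / 2" using val[of e] by blast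
        then show ?thesis
        proof cases
          case 3
          show ?thesis using \<open>e \<in> {1..n}\<close> unfolding X_def Y_def mem_Collect_eq 3 by simp
        qed (use \<open>e \<in> {1..n}\<close> in \<open>simp_all add: X_def Y_def\<close>)
      qed
    qed
    also have "\<dots> = real (card ({1..n} \<inter> {e. e \<in> X})) + real (card ({1..n} \<inter> {e. e \<in> Y})) / 4"
      by (simp add: sum.distrib sum_divide_distrib[symmetric])
    also have "{1..n} \<inter> {e. e \<in> X} = X" unfolding X_def by blast
    also have "{1..n} \<inter> {e. e \<in> Y} = Y" unfolding Y_def by blast
    finally have "real (4 * card X + card Y) = real (4 * l)" by simp
    then show ?thesis by (simp only: of_nat_eq_iff)
  qed
  moreover have "card X + card Y \<le> n"
  proof -
    have "card X + card Y = card (X \<union> Y)"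
      by (rule card_Un_disjoint[symmetric]) (auto simp: X_def Y_def)
    also have "\<dots> \<le> card {1..n}" by (rule card_mono) (auto simp: X_def Y_def)
    finally show ?thesis by simp
  qed
  ultimately show ?thesis using b4 by auto
next
  case False
  have odd: "odd_comp C" if "C \<in> bads 2 \<union> bads 4" for C
    using that False bad_two_odd_or_half bad_four_odd unfolding bads_def by blast
  have "card (bads 2 \<union> bads 4) \<le> 1"
    using odd odd_comp_unique bads_subset finite_bads by (simp add: card_le_Suc0_iff_eq) blast
  moreover have "card (bads 2 \<union> bads 4) = card (bads 2) + card (bads 4)"
    by (rule card_Un_disjoint[OF finite_bads finite_bads]) (auto simp: bads_def)
  ultimately show ?thesis by linarith
qed

text \<open>A kernel vector of nonzero sum expresses a nonzero multiple of \<open>u e\<close>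
  through the members of \<open>C\<close> that contain \<open>e\<close>.\<close>

lemma bad_covers:
  assumes "bad C" "u e \<noteq> 0"
  shows "\<exists>A\<in>C. e \<in> A"
proof (rule ccontr)
  assume no: "\<not> ?thesis"
  have C: "C \<subseteq> Fam" using assms(1) comps_subset by (simp add: bad_def)
  obtain k where k: "kern k" "\<forall>A. A \<notin> C \<longrightarrow> k A = 0" "(\<Sum>A\<in>C. k A) \<noteq> 0"
    using bad_kern[OF assms(1)] by blast
  have "(\<Sum>A\<in>C. k A * ind A e) = (\<Sum>A\<in>C. k A) * u e"
    using kern_center_support[OF center k(1) C, of e] k(2) by blast
  moreover have "(\<Sum>A\<in>C. k A * ind A e) = 0" using no by (intro sum.neutral) auto
  ultimately show False using k(3) assms(2) by simp
qed

text \<open>Every element of the support of \<open>u\<close> is covered by each bad component, so it lies in one of the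
  25 intersections, each of size \<open>l\<close>, between two bad components of size five.\<close>

lemma card_bads_five: "card (bads 5) \<le> 25 * l + 1"
proof (cases "card (bads 5) \<le> 1")
  case False
  then obtain C C' where C: "C \<in> bads 5" "C' \<in> bads 5" "C \<noteq> C'"
    using finite_bads[of 5] by (auto simp: card_le_Suc0_iff_eq)
  define Z where "Z = {e \<in> {1..n}. u e \<noteq> 0}"
  \<comment> \<open>Each component of size five has two members differing only on the support of
    \<open>u\<close>.\<close>
  have "card (bads 5) \<le> card Z"
  proof (rule card_supported_le[OF bads_subset])
    fix C assume "C \<in> bads 5"
    then obtain A B where "A \<in> C" "B \<in> C" "A \<noteq> B" "\<And>e. u e = 0 \<Longrightarrow> e \<in> A \<longleftrightarrow> e \<in> B"
      using bad_five_pair[of C] unfolding bads_def by blast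
    then show "\<exists>A\<in>C. \<exists>B\<in>C. A \<noteq> B \<and> (\<forall>e\<in>{1..n}. e \<notin> Z \<longrightarrow> (e \<in> A \<longleftrightarrow> e \<in> B))"
      unfolding Z_def by blast
  qed (auto simp: Z_def)
  also have "card Z \<le> card (\<Union>(A, B)\<in>C \<times> C'. A \<inter> B)"
  proof (rule card_mono)
    have "A \<inter> B \<subseteq> {1..n}" if "A \<in> C" for A B
      using that C(1) bads_subset comps_subset Fam_subset by blast
    then have "(\<Union>(A, B)\<in>C \<times> C'. A \<inter> B) \<subseteq> {1..n}" by blast
    then show "finite (\<Union>(A, B)\<in>C \<times> C'. A \<inter> B)" by (rule finite_subset) simp
    show "Z \<subseteq> (\<Union>(A, B)\<in>C \<times> C'. A \<inter> B)"
    proof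
      fix e assume "e \<in> Z"
      then have "u e \<noteq> 0" by (simp add: Z_def)
      moreover have "bad C" "bad C'" using C(1,2) by (auto simp: bads_def)
      ultimately obtain A B where "A \<in> C" "B \<in> C'" "e \<in> A" "e \<in> B"
        using bad_covers[of C e] bad_covers[of C' e] by blast
      then show "e \<in> (\<Union>(A, B)\<in>C \<times> C'. A \<inter> B)" by blast
    qed
  qed
  also have "\<dots> \<le> (\<Sum>(A, B)\<in>C \<times> C'. card (A \<inter> B))"
    using card_UN_le[of "C \<times> C'" "\<lambda>(A, B). A \<inter> B"] C comps_finite bads_subset
    by (simp add: case_prod_unfold finite_cartesian_product subset_iff)
  also have "\<dots> = (\<Sum>(A, B)\<in>C \<times> C'. l)"
  proof (rule sum.cong[OF refl], clarify)
    fix A B assume "A \<in> C" "B \<in> C'"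
    then have "b A B = 0" using comps_b[of C C' A B] C bads_subset by blast
    then show "card (A \<inter> B) = l" by (simp add: b_def)
  qed
  also have "\<dots> = 25 * l" using C(1,2) by (simp add: bads_def card_cartesian_product case_prod_unfold)
  finally show ?thesis by simp
qed simp

lemma sum_bads: "(\<Sum>C\<in>comps. of_bool (C \<in> bads c)) = card (bads c)"
proof -
  have "comps \<inter> {C. C \<in> bads c} = bads c" using bads_subset by blast
  then show ?thesis using finite_comps by simp
qed

text \<open>The corrections are the positive excesses \<open>2 c - 3 r\<close>,
  \<open>3 c - 5 r\<close>, \<open>c - 2 r\<close> of the types (1, 0), (2, 1), (4, 2), (5, 3).
  Slope 5/3 absorbs type (5, 3), and slope 2 absorbs all types but (1, 0).\<close>

lemma comps_estimates:
  assumes "C \<in> comps"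
  shows "2 * card C \<le> 3 * rk C + 2 * of_bool (C \<in> bads 1) + of_bool (C \<in> bads 2)
      + 2 * of_bool (C \<in> bads 4) + of_bool (C \<in> bads 5)"
    "3 * card C \<le> 5 * rk C + 3 * of_bool (C \<in> bads 1) + of_bool (C \<in> bads 2) + 2 * of_bool (C \<in> bads 4)"
    "card C \<le> 2 * rk C + of_bool (C \<in> bads 1)"
proof -
  have "bad C \<or> 2 * card C \<le> 3 * rk C" using assms by (auto simp: bad_def)
  then show "2 * card C \<le> 3 * rk C + 2 * of_bool (C \<in> bads 1) + of_bool (C \<in> bads 2)
      + 2 * of_bool (C \<in> bads 4) + of_bool (C \<in> bads 5)"
    "3 * card C \<le> 5 * rk C + 3 * of_bool (C \<in> bads 1) + of_bool (C \<in> bads 2) + 2 * of_bool (C \<in> bads 4)"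
    "card C \<le> 2 * rk C + of_bool (C \<in> bads 1)"
    using bad_cases[of C] unfolding bads_def by auto
qed

lemma card_Fam_estimates:
  shows "2 * card Fam \<le> 3 * (\<Sum>C\<in>comps. rk C) + 2 * card (bads 1) + card (bads 2)
      + 2 * card (bads 4) + card (bads 5)"
    "3 * card Fam \<le> 5 * (\<Sum>C\<in>comps. rk C) + 3 * card (bads 1) + card (bads 2) + 2 * card (bads 4)"
    "card Fam \<le> 2 * (\<Sum>C\<in>comps. rk C) + card (bads 1)"
  unfolding card_Fam sum_bads[symmetric] sum_distrib_left sum.distrib[symmetric]
  by (intro sum_mono comps_estimates; assumption)+

end

section \<open>The bounds for one family and for the maximum\<close>

context fisher_family
begin

lemma card_Fam_not_bad:
  assumes "\<nexists>C. bad C"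
  shows "2 * card Fam \<le> 3 * (n + 1)"
proof -
  have "2 * card Fam = (\<Sum>C\<in>comps. 2 * card C)" by (simp add: card_Fam sum_distrib_left)
  also have "\<dots> \<le> (\<Sum>C\<in>comps. 3 * rk C)" using assms by (intro sum_mono) (auto simp: bad_def)
  also have "\<dots> = 3 * (\<Sum>C\<in>comps. rk C)" by (simp add: sum_distrib_left)
  also have "\<dots> \<le> 3 * (n + 1)" using sum_rk_le by simp
  finally show ?thesis .
qed

lemma card_Fam_bounds:
  assumes "20 \<le> n" "l \<le> n"
  shows "card Fam + 2 \<le> 2 * n" "3 * card Fam \<le> 5 * n + 7 + 4 * l" "9 * card Fam + 4 * l \<le> 19 * n + 21"
    "2 * card Fam \<le> 3 * n + 29 * l + 8"
proof -
  have "card Fam + 2 \<le> 2 * n \<and> 3 * card Fam \<le> 5 * n + 7 + 4 * l \<and> 9 * card Fam + 4 * l \<le> 19 * n + 21 \<and>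
    2 * card Fam \<le> 3 * n + 29 * l + 8"
  proof (cases "\<exists>C. bad C")
    case False
    then have "2 * card Fam \<le> 3 * n + 3" using card_Fam_not_bad by simp
    then have "card Fam + 2 \<le> 2 * n" "3 * card Fam \<le> 5 * n + 7 + 4 * l" "9 * card Fam + 4 * l \<le> 19 * n + 21"
      "2 * card Fam \<le> 3 * n + 29 * l + 8"
      using assms by linarith+
    then show ?thesis by blast
  next
    case True
    then obtain u where u: "center u" using bad_center by blast
    interpret centered_family n l Fam u by unfold_locales (rule u)
    note E = card_Fam_estimates
    note P = pairs_bound
    have R: "(\<Sum>C\<in>comps. rk C) \<le> n" using sum_rk_le_center[OF u] .
    have B5: "card (bads 5) \<le> 25 * l + 1" by (rule card_bads_five)
    have B1: "card (bads 1) \<le> 1" by (rule card_bads_one)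
    show ?thesis
    proof (cases "l = 0 \<or> bads 1 \<noteq> {}")
      case True
      then have "u e \<in> {0, 1}" for e using bads_one_center l_zero_center by blast
      then have "bads 2 = {}" "bads 4 = {}" by (rule zero_one_center)+
      then have "card (bads 2) = 0" "card (bads 4) = 0" by simp_all
      \<comment> \<open>Here the total rank may be \<open>n\<close>, but slope 5/3 gives
        \<open>3 * card Fam \<le> 5 * n + 3\<close>, which is at most \<open>6 * n - 6\<close> once
        \<open>n \<ge> 9\<close>.\<close>
      have "card Fam + 2 \<le> 2 * n" "3 * card Fam \<le> 5 * n + 7 + 4 * l" "9 * card Fam + 4 * l \<le> 19 * n + 21"
        "2 * card Fam \<le> 3 * n + 29 * l + 8"
        using E R B1 B5 assms \<open>card (bads 2) = 0\<close> \<open>card (bads 4) = 0\<close> by linarith+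
      then show ?thesis by blast
    next
      case False
      then have "(\<Sum>C\<in>comps. rk C) + 1 \<le> n" "card (bads 1) = 0"
        using sum_rk_le_center_pos[OF u] by auto
      \<comment> \<open>The total rank is at most \<open>n - 1\<close>, so slope 2 gives
        \<open>2 * n - 2\<close>. In the last bound \<open>29 * l\<close> is \<open>25 * l\<close>
        from size five plus \<open>4 * l\<close> from \<open>pairs_bound\<close>.\<close>
      have "card Fam + 2 \<le> 2 * n" "3 * card Fam \<le> 5 * n + 7 + 4 * l" "9 * card Fam + 4 * l \<le> 19 * n + 21"
        "2 * card Fam \<le> 3 * n + 29 * l + 8"
        using E P B5 assms \<open>(\<Sum>C\<in>comps. rk C) + 1 \<le> n\<close> \<open>card (bads 1) = 0\<close> by linarith+
      then show ?thesis by blast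
    qed
  qed
  then show "card Fam + 2 \<le> 2 * n" "3 * card Fam \<le> 5 * n + 7 + 4 * l" "9 * card Fam + 4 * l \<le> 19 * n + 21"
    "2 * card Fam \<le> 3 * n + 29 * l + 8" by blast+
qed

end

lemma max_almost_fisher_bounds:
  assumes "20 \<le> n" "l \<le> n"
  shows "max_almost_fisher n 2 l + 2 \<le> 2 * n"
    "3 * max_almost_fisher n 2 l \<le> 5 * n + 7 + 4 * l"
    "9 * max_almost_fisher n 2 l + 4 * l \<le> 19 * n + 21"
    "2 * max_almost_fisher n 2 l \<le> 3 * n + 29 * l + 8"
proof -
  have "max_almost_fisher n 2 l \<in> {card \<F> | \<F>. almost_fisher n 2 l \<F>}"
    unfolding max_almost_fisher_def by (rule Max_in[OF finite_almost_fisher_cards almost_fisher_cards_nonempty])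
  then obtain \<F> where F: "almost_fisher n 2 l \<F>" and m: "max_almost_fisher n 2 l = card \<F>" by blast
  interpret fisher_family n l \<F> by unfold_locales (rule F)
  show "max_almost_fisher n 2 l + 2 \<le> 2 * n"
    "3 * max_almost_fisher n 2 l \<le> 5 * n + 7 + 4 * l"
    "9 * max_almost_fisher n 2 l + 4 * l \<le> 19 * n + 21"
    "2 * max_almost_fisher n 2 l \<le> 3 * n + 29 * l + 8"
    unfolding m using card_Fam_bounds[OF assms] by blast+
qed

theorem theorem1p6:
  shows "(\<exists>N::nat. \<forall>n\<ge>N. \<forall>l\<le>n.
            real (max_almost_fisher n 2 l) \<le> 2 * real n - 2 \<and>
            real (max_almost_fisher n 2 l)
              \<le> 1 / 3 * (5 * real n + 4 * min (real l) ((real n - real l) / 3) + 7))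
       \<and> (\<forall>l :: nat \<Rightarrow> nat.
            (\<forall>n. l n \<le> n) \<longrightarrow> (\<lambda>n. real (l n)) \<in> o(\<lambda>n. real n) \<longrightarrow>
            (\<exists>\<epsilon> :: nat \<Rightarrow> real. \<epsilon> \<in> o(\<lambda>n. 1) \<and>
               (\<forall>\<^sub>F n in sequentially.
                  real (max_almost_fisher n 2 (l n)) \<le> (3 / 2 + \<epsilon> n) * real n)))"
proof (intro conjI allI impI)
  show "\<exists>N::nat. \<forall>n\<ge>N. \<forall>l\<le>n.
            real (max_almost_fisher n 2 l) \<le> 2 * real n - 2 \<and>
            real (max_almost_fisher n 2 l)
              \<le> 1 / 3 * (5 * real n + 4 * min (real l) ((real n - real l) / 3) + 7)"
  proof (intro exI[of _ 20] allI impI)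
    fix n l :: nat assume "20 \<le> n" "l \<le> n"
    note B = max_almost_fisher_bounds[OF this]
    let ?m = "real (max_almost_fisher n 2 l)"
    \<comment> \<open>The last two inequalities are the two branches of the minimum, multiplied by 3
      and by 9.\<close>
    have "?m + 2 \<le> 2 * real n" "3 * ?m \<le> 5 * real n + 7 + 4 * real l"
      "9 * ?m + 4 * real l \<le> 19 * real n + 21"
      using B(1-3) by linarith+
    then show "?m \<le> 2 * real n - 2 \<and>
        ?m \<le> 1 / 3 * (5 * real n + 4 * min (real l) ((real n - real l) / 3) + 7)"
      by (simp add: min_def field_simps)
  qed
next
  fix l :: "nat \<Rightarrow> nat"
  assume l: "\<forall>n. l n \<le> n" and o: "(\<lambda>n. real (l n)) \<in> o(\<lambda>n. real n)"
  \<comment> \<open>Half of \<open>29 * l + 8\<close>, with 29/2 rounded up to 15, divided by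
    \<open>n\<close>.\<close>
  define \<epsilon> where "\<epsilon> = (\<lambda>n. 15 * (real (l n) / real n) + 4 * (1 / real n))"
  have "(\<lambda>n. real (l n) / real n) \<longlonglongrightarrow> 0" by (rule smalloD_tendsto[OF o])
  then have "\<epsilon> \<longlonglongrightarrow> 15 * 0 + 4 * 0"
    unfolding \<epsilon>_def by (intro tendsto_intros lim_1_over_n)
  then have "\<epsilon> \<in> o(\<lambda>n. 1)" by (intro smalloI_tendsto) auto
  moreover have "\<forall>\<^sub>F n in sequentially. real (max_almost_fisher n 2 (l n)) \<le> (3 / 2 + \<epsilon> n) * real n"
    using eventually_ge_at_top[of 20]
  proof eventually_elim
    case (elim n)
    have "2 * max_almost_fisher n 2 (l n) \<le> 3 * n + 29 * l n + 8"
      using max_almost_fisher_bounds(4) elim l by blast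
    then have "real (max_almost_fisher n 2 (l n)) \<le> 3 / 2 * real n + 15 * real (l n) + 4" by linarith
    also have "\<dots> = (3 / 2 + \<epsilon> n) * real n" using elim by (simp add: \<epsilon>_def field_simps)
    finally show ?case .
  qed
  ultimately show "\<exists>\<epsilon> :: nat \<Rightarrow> real. \<epsilon> \<in> o(\<lambda>n. 1) \<and>
      (\<forall>\<^sub>F n in sequentially. real (max_almost_fisher n 2 (l n)) \<le> (3 / 2 + \<epsilon> n) * real n)"
    by blast
qed

end
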